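(* There exists $\bar n_1$ such that for every $n\ge \bar n_1$ and every integer $m$ with $\binom{\lfloor n/2\rfloor}{2}-\frac n5\le m\le \binom{\lfloor n/2\rfloor}{2}$, each $4$-graph in $\mathcal F(n,m)$ is a subgraph of a thick clique on $n$ vertices. Moreover, there exists $\tilde n_1$ such that for every $n\ge \tilde n_1$ and all $m\ge \binom{\lfloor n/2\rfloor}{2}+1$, each $4$-graph in $\mathcal F(n,m)$ has maximum degree at least $n^2/32-n$, and one can delete from it at most $470$ edges to obtain a union of at most four $2$-stars and some number of isolated vertices.
   Context: A $4$-graph $H=(V,E)$ is a family of distinct $4$-element subsets (edges) of a finite vertex set $V$; $\Delta(H)$ denotes its maximum degree (degree = number of edges containing a vertex). $P^4_2$ denotes the loose path of length two: two edges sharing exactly one vertex; $H$ is $P^4_2$-free if it contains no copy of it. Define $f(n,m)=\min\{\Delta(H): H$ is a $P^4_2$-free $4$-graph with $n$ vertices and $m$ edges$\}$ and let $\mathcal F(n,m)$ be the family of $P^4_2$-free $4$-graphs on $n$ vertices with $m$ edges and $\Delta(H)=f(n,m)$. The thick clique on $n$ vertices is the $4$-graph whose vertex set is partitioned into $\lfloor n/2\rfloor$ disjoint pairs (plus one extra vertex if $n$ is odd) and whose edges are all unions of two distinct such pairs. A $2$-star is a $4$-graph in which all edges contain two fixed vertices (its center). *)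

theory Defs
  imports Complex_Main "HOL-Library.Disjoint_Sets"
begin

type_synonym 'a hypergraph = "'a set \<times> 'a set set"

abbreviation verts :: "'a hypergraph \<Rightarrow> 'a set" where "verts \<equiv> fst"
abbreviation edges :: "'a hypergraph \<Rightarrow> 'a set set" where "edges \<equiv> snd"

definition four_graph :: "'a hypergraph \<Rightarrow> bool" where
  "four_graph H \<longleftrightarrow> finite (verts H) \<and> (\<forall>e\<in>edges H. e \<subseteq> verts H \<and> card e = 4)"

definition subgraph :: "'a hypergraph \<Rightarrow> 'a hypergraph \<Rightarrow> bool" where
  "subgraph G H \<longleftrightarrow> verts G \<subseteq> verts H \<and> edges G \<subseteq> edges H"

definition degree :: "'a hypergraph \<Rightarrow> 'a \<Rightarrow> nat" where
  "degree H v = card {e \<in> edges H. v \<in> e}"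

(* The inserted 0 only matters when there are no vertices. *)
definition max_degree :: "'a hypergraph \<Rightarrow> nat" where
  "max_degree H = Max (insert 0 (degree H ` verts H))"

definition P42_free :: "'a hypergraph \<Rightarrow> bool" where
  "P42_free H \<longleftrightarrow> \<not> (\<exists>e\<in>edges H. \<exists>e'\<in>edges H. card (e \<inter> e') = 1)"

definition P42_free_four_graphs :: "nat \<Rightarrow> nat \<Rightarrow> 'a hypergraph set" where
  "P42_free_four_graphs n m =
     {H. four_graph H \<and> P42_free H \<and> card (verts H) = n \<and> card (edges H) = m}"

(* Every finite 4-graph is isomorphic to one whose vertices are natural numbers, so the
   minimum over the vertex type nat is the minimum over all 4-graphs. If there is no
   P42-free 4-graph with n vertices and m edges, the value is irrelevant. *)
definition min_max_degree :: "nat \<Rightarrow> nat \<Rightarrow> nat" where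
  "min_max_degree n m =
     (LEAST d. \<exists>H \<in> (P42_free_four_graphs n m :: nat hypergraph set). max_degree H = d)"

definition extremal_family :: "nat \<Rightarrow> nat \<Rightarrow> 'a hypergraph set" where
  "extremal_family n m =
     {H \<in> P42_free_four_graphs n m. max_degree H = min_max_degree n m}"

(* Having (card V) div 2 disjoint pairs inside V means that all of V, or all of V but one
   vertex, is covered, according to the parity of card V. *)
definition thick_clique :: "'a hypergraph \<Rightarrow> bool" where
  "thick_clique H \<longleftrightarrow> finite (verts H) \<and>
     (\<exists>P. (\<forall>p\<in>P. p \<subseteq> verts H \<and> card p = 2) \<and> disjoint P \<and>
          card P = card (verts H) div 2 \<and>
          edges H = {p \<union> q | p q. p \<in> P \<and> q \<in> P \<and> p \<noteq> q})"

definition two_star :: "'a hypergraph \<Rightarrow> bool" where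
  "two_star H \<longleftrightarrow> four_graph H \<and>
     (\<exists>u\<in>verts H. \<exists>v\<in>verts H. u \<noteq> v \<and> (\<forall>e\<in>edges H. u \<in> e \<and> v \<in> e))"

(* Vertex-disjoint union of at most k 2-stars; the vertices of H outside the stars
   are isolated because every edge of H belongs to one of the stars. *)
definition union_of_two_stars :: "nat \<Rightarrow> 'a hypergraph \<Rightarrow> bool" where
  "union_of_two_stars k H \<longleftrightarrow>
     (\<exists>S. finite S \<and> card S \<le> k \<and>
          (\<forall>s\<in>S. two_star s \<and> verts s \<subseteq> verts H) \<and>
          pairwise (\<lambda>s t. disjnt (verts s) (verts t)) S \<and>
          edges H = (\<Union>s\<in>S. edges s))"

end

theory Submission
  imports Defs
begin

text \<open>
  Since no two edges of \<open>H\<close> meet in exactly one vertex, call a pair \<open>p\<close> a kernel if it is the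
  intersection of two edges and every edge contains or avoids it. Kernels are disjoint, so an edge
  is a union of two kernels (a thick clique edge), or contains one kernel (an edge of the 2-star
  centred there), or contains none. A pair that is not a kernel has a link graph covered by three
  vertices, which bounds the number of edges without kernels, and of those in degenerate stars, by
  \<open>49/4\<close> times the number \<open>w\<close> of vertices outside the kernels and the star leaves. With \<open>k\<close> kernels and
  leaf sets of sizes \<open>r\<^sub>p\<close> this gives \<open>m \<le> C(k,2) + \<Sum> min (C(r\<^sub>p,2), \<Delta>) + 49w/4\<close>, where
  \<open>2k + \<Sum> r\<^sub>p + w = n\<close>. If the stars are sparse and \<open>m\<close> is close to \<open>C(n/2,2)\<close>, this forces \<open>k\<close> to be
  maximal, hence a thick clique. For larger \<open>m\<close>, extremality says that no disjoint union of 2-stars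
  with at most \<open>\<Delta> - 1\<close> edges each has \<open>m\<close> edges. Moving leaves between stars would produce such a union
  unless at most four stars carry all but boundedly many edges.
\<close>

section \<open>Kernels\<close>

text \<open>The obstacle is that two very different configurations have almost the same size: a
  thick clique has about n^2/8 edges, and so do four disjoint 2-stars on n/4 vertices each, with
  about n^2/32 edges apiece. Giving up t of the n/2 possible kernels loses at least about t n / 4
  unions of kernels and frees about 2 t vertices, so the break-even rate is n/8 edges per freed
  vertex, which is the rate of a complete star on n/4 vertices. Rates strictly below n/8 allow crude
  estimates; at the critical rate the linear terms must be kept, and the degree bound becomes n^2/32
  + n/8 = C(n/4 + 1, 2).

  This sharper value also controls the exchanges. A competing star may have at most
  \<open>d - 1\<close> edges, so a star with \<open>d\<close> edges loses one when it is kept; since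
  four blocks with more than n/4 leaves do not fit into n vertices, at most three edges are lost in
  this way.

  The constant 49/4 is 27/4 + 4 + 3/2: kernel-free edges without a much extended triple, those
  containing such a triple, and edges over link pairs in the core.\<close>

locale single_free =
  fixes V :: "'a set" and E :: "'a set set"
  assumes finite_V: "finite V"
    and edge_subset: "e \<in> E \<Longrightarrow> e \<subseteq> V"
    and card_edge: "e \<in> E \<Longrightarrow> card e = 4"
    and card_Int_edges: "e \<in> E \<Longrightarrow> e' \<in> E \<Longrightarrow> card (e \<inter> e') \<noteq> 1"
begin

lemma finite_E: "finite E"
  using finite_V edge_subset by (meson PowI finite_Pow_iff finite_subset subsetI)

lemma finite_edge: "e \<in> E \<Longrightarrow> finite e"
  using card_edge card.infinite by fastforce

lemma edges_meet_again:
  assumes "e \<in> E" "e' \<in> E" "v \<in> e" "v \<in> e'"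
  shows "\<exists>x. x \<noteq> v \<and> x \<in> e \<and> x \<in> e'"
proof (rule ccontr)
  assume "\<not> ?thesis"
  then have "e \<inter> e' = {v}" using assms by blast
  then show False using card_Int_edges[OF assms(1,2)] by simp
qed

text \<open>The existence of two edges meeting exactly in \<open>p\<close> is what makes kernels
  disjoint: another kernel touching \<open>p\<close> would lie in both edges, hence in
  \<open>p\<close>.\<close>

definition kernel :: "'a set \<Rightarrow> bool" where
  "kernel p \<longleftrightarrow> card p = 2 \<and> (\<forall>e\<in>E. card (p \<inter> e) \<noteq> 1) \<and> (\<exists>e\<in>E. \<exists>e'\<in>E. e \<inter> e' = p)"

lemma card_two_Int_cases:
  assumes "card p = 2" "card (p \<inter> e) \<noteq> 1"
  shows "p \<inter> e = {} \<or> p \<subseteq> e"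
proof -
  have fin: "finite p" using assms(1) card.infinite by fastforce
  have "card (p \<inter> e) \<le> 2" using assms(1) fin by (metis Int_lower1 card_mono)
  then consider "card (p \<inter> e) = 0" | "card (p \<inter> e) = 2" using assms(2) by linarith
  then show ?thesis
  proof cases
    case 1 then show ?thesis using fin by simp
  next
    case 2 then show ?thesis using assms(1) fin
      by (metis Int_lower1 card_subset_eq inf.orderI)
  qed
qed

lemma kernel_edge: "kernel p \<Longrightarrow> e \<in> E \<Longrightarrow> p \<inter> e = {} \<or> p \<subseteq> e"
  using card_two_Int_cases unfolding kernel_def by blast

lemma kernel_disjoint:
  assumes "kernel p" "kernel q" "p \<inter> q \<noteq> {}"
  shows "p = q"
proof -
  obtain e e' where e: "e \<in> E" "e' \<in> E" "e \<inter> e' = p" using assms(1) unfolding kernel_def by blast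
  have "q \<subseteq> e" "q \<subseteq> e'" using kernel_edge[OF assms(2)] e assms(3) by blast+
  then have "q \<subseteq> p" using e by blast
  moreover have "card q = 2" "card p = 2" using assms unfolding kernel_def by auto
  ultimately show ?thesis by (metis card.infinite card_subset_eq zero_neq_numeral)
qed

text \<open>An edge meeting \<open>p\<close> in a single vertex would have to meet each member of
  the sunflower \<open>A\<close> again, in pairwise distinct vertices outside \<open>p\<close>. It
  has only three such vertices, so four petals suffice.\<close>

lemma kernelI_four:
  assumes p: "card p = 2" and A: "A \<subseteq> E" "card A \<ge> 4"
    and meet: "\<And>e e'. e \<in> A \<Longrightarrow> e' \<in> A \<Longrightarrow> e \<noteq> e' \<Longrightarrow> e \<inter> e' = p"
  shows "kernel p"
proof -
  have two: "\<exists>e'\<in>A. e' \<noteq> e" if "e \<in> A" for e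
  proof (rule ccontr)
    assume "\<not> ?thesis"
    then have "A \<subseteq> {e}" by blast
    then have "card A \<le> 1" by (metis card_mono finite.emptyI finite_insert card.empty card_insert_disjoint empty_iff One_nat_def)
    then show False using A(2) by simp
  qed
  have pe: "p \<subseteq> e" if "e \<in> A" for e using two[OF that] meet that by blast
  have meets: "card (p \<inter> g) \<noteq> 1" if g: "g \<in> E" for g
  proof
    assume c: "card (p \<inter> g) = 1"
    then obtain u where u: "p \<inter> g = {u}" by (meson card_1_singletonE)
    have "\<exists>x. x \<in> e \<and> x \<in> g - p" if "e \<in> A" for e
    proof -
      have "e \<in> E" "u \<in> e" "u \<in> g" using that A(1) pe u by blast+
      then obtain x where "x \<noteq> u" "x \<in> e" "x \<in> g" using edges_meet_again g by blast
      then show ?thesis using u by blast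
    qed
    then obtain f where f: "\<And>e. e \<in> A \<Longrightarrow> f e \<in> e \<and> f e \<in> g - p" by metis
    have "inj_on f A"
    proof (rule inj_onI, rule ccontr)
      fix e e' assume e: "e \<in> A" "e' \<in> A" "f e = f e'" "e \<noteq> e'"
      then have "f e \<in> e \<inter> e'" using f[of e] f[of e'] by simp
      then show False using meet[OF e(1,2,4)] f[of e] e(1) by simp
    qed
    then have "card A \<le> card (g - p)"
      using f finite_edge[OF g] by (intro card_inj_on_le[of f]) auto
    moreover have "card (g - p) = 3"
      using card_Diff_subset_Int[of g p] c card_edge[OF g] finite_edge[OF g] by (simp add: Int_commute)
    ultimately show False using A(2) by simp
  qed
  obtain e where e: "e \<in> A" using A(2) by (metis card.empty equals0I not_numeral_le_zero)
  then obtain e' where e': "e' \<in> A" "e' \<noteq> e" using two by blast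
  have "\<exists>e\<in>E. \<exists>e'\<in>E. e \<inter> e' = p" using meet[OF e e'(1)] e e' A(1) by (metis subsetD)
  then show ?thesis unfolding kernel_def using p meets by simp
qed

text \<open>Either way of failing to be a kernel yields a cover. An edge meeting the pair once is
  met again by every edge through the pair; and if no two edges meet exactly in the pair, then
  \<open>e0\<close> minus the pair is hit by every edge through it.\<close>

lemma non_kernel_cover:
  assumes "\<not> kernel {v, a}" "v \<noteq> a" "e0 \<in> E" "{v, a} \<subseteq> e0"
  obtains g where "finite g" "card g \<le> 3" "g \<inter> {v, a} = {}"
    "\<And>e. e \<in> E \<Longrightarrow> {v, a} \<subseteq> e \<Longrightarrow> e \<inter> g \<noteq> {}"
proof (cases "\<exists>g\<in>E. card ({v, a} \<inter> g) = 1")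
  case True
  then obtain g where g: "g \<in> E" "card ({v, a} \<inter> g) = 1" by blast
  then obtain u where u: "{v, a} \<inter> g = {u}" by (meson card_1_singletonE)
  show ?thesis
  proof (rule that[of "g - {v, a}"])
    show "finite (g - {v, a})" using finite_edge[OF g(1)] by simp
    show "card (g - {v, a}) \<le> 3"
      using card_Diff_subset_Int[of g "{v, a}"] g card_edge[OF g(1)] by (simp add: Int_commute)
    show "(g - {v, a}) \<inter> {v, a} = {}" by blast
    fix e assume e: "e \<in> E" "{v, a} \<subseteq> e"
    then have "u \<in> e" "u \<in> g" using u by blast+
    then obtain x where "x \<noteq> u" "x \<in> e" "x \<in> g" using edges_meet_again[OF e(1) g(1)] by blast
    then show "e \<inter> (g - {v, a}) \<noteq> {}" using u by blast
  qed
next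
  case False
  have no: "e \<inter> e' \<noteq> {v, a}" if "e \<in> E" "e' \<in> E" for e e'
    using that assms(1,2) False unfolding kernel_def by auto
  show ?thesis
  proof (rule that[of "e0 - {v, a}"])
    show "finite (e0 - {v, a})" using finite_edge[OF assms(3)] by simp
    show "card (e0 - {v, a}) \<le> 3"
      using assms card_edge[OF assms(3)] by (simp add: card_Diff_subset)
    show "(e0 - {v, a}) \<inter> {v, a} = {}" by blast
    fix e assume e: "e \<in> E" "{v, a} \<subseteq> e"
    then show "e \<inter> (e0 - {v, a}) \<noteq> {}" using no[OF e(1) assms(3)] assms(4) by blast
  qed
qed

section \<open>Triples with at least four extensions to an edge\<close>

definition ext :: "'a set \<Rightarrow> 'a set" where
  "ext T = {x. x \<notin> T \<and> insert x T \<in> E}"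

definition triple_kernel :: "'a set \<Rightarrow> bool" where
  "triple_kernel T \<longleftrightarrow> card T = 3 \<and> card (ext T) \<ge> 4"

lemma finite_ext: "finite (ext T)"
  by (rule finite_subset[OF _ finite_V]) (use edge_subset ext_def in blast)

text \<open>An edge meeting \<open>T\<close> only in v must meet each edge \<open>insert x T\<close>
  a second time, necessarily in x. Besides v it would contain at least four extensions.\<close>

lemma triple_kernel_edge:
  assumes T: "triple_kernel T" and e: "e \<in> E"
  shows "card (e \<inter> T) \<noteq> 1"
proof
  assume "card (e \<inter> T) = 1"
  then obtain v where v: "e \<inter> T = {v}" by (meson card_1_singletonE)
  have "ext T \<subseteq> e - {v}"
  proof
    fix x assume x: "x \<in> ext T"
    then have "insert x T \<in> E" "x \<notin> T" unfolding ext_def by auto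
    then obtain y where "y \<noteq> v" "y \<in> e" "y \<in> insert x T"
      using edges_meet_again[OF e \<open>insert x T \<in> E\<close>, of v] v by auto
    then have "y = x" using v by blast
    then show "x \<in> e - {v}" using \<open>y \<in> e\<close> \<open>y \<noteq> v\<close> by blast
  qed
  then have "card (ext T) \<le> card (e - {v})" using finite_edge[OF e] by (intro card_mono) auto
  also have "\<dots> = 3" using v card_edge[OF e] by (subst card_Diff_singleton) auto
  finally show False using T unfolding triple_kernel_def by simp
qed

lemma finite_triple_kernels: "finite {T. triple_kernel T \<and> Q T}"
proof (rule finite_subset[of _ "Pow V"])
  show "{T. triple_kernel T \<and> Q T} \<subseteq> Pow V"
  proof clarify
    fix T x assume "triple_kernel T" "x \<in> T"
    then have "ext T \<noteq> {}" unfolding triple_kernel_def by auto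
    then obtain y where "insert y T \<in> E" unfolding ext_def by blast
    then show "x \<in> V" using edge_subset \<open>x \<in> T\<close> by blast
  qed
qed (simp add: finite_V)

text \<open>The third vertex of such a triple lies in the cover of the pair; otherwise all
  extensions would have to lie in the cover, which has at most three vertices.\<close>

lemma card_triple_kernels_over_pair:
  assumes "\<not> kernel {u, v}" "u \<noteq> v"
  shows "card {T. triple_kernel T \<and> {u, v} \<subseteq> T} \<le> 3"
proof (cases "\<exists>e0\<in>E. {u, v} \<subseteq> e0")
  case True
  then obtain g where g: "finite g" "card g \<le> 3" "g \<inter> {u, v} = {}"
      "\<And>e. e \<in> E \<Longrightarrow> {u, v} \<subseteq> e \<Longrightarrow> e \<inter> g \<noteq> {}"
    using non_kernel_cover[OF assms] by metis
  have "{T. triple_kernel T \<and> {u, v} \<subseteq> T} \<subseteq> (\<lambda>z. {u, v, z}) ` g"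
  proof clarify
    fix T assume T: "triple_kernel T" "{u, v} \<subseteq> T"
    have "finite T" "card T = 3" using T(1) card_ge_0_finite[of T] unfolding triple_kernel_def by simp_all
    then have "card (T - {u, v}) = 1" using T(2) assms(2) by (simp add: card_Diff_subset)
    then obtain z where z: "T - {u, v} = {z}" by (meson card_1_singletonE)
    then have Tz: "T = {u, v, z}" using T(2) by blast
    have "z \<in> g"
    proof (rule ccontr)
      assume zg: "z \<notin> g"
      have "ext T \<subseteq> g"
      proof
        fix y assume "y \<in> ext T"
        then have "insert y T \<in> E" unfolding ext_def by blast
        then have "insert y T \<inter> g \<noteq> {}" using g(4) T(2) by blast
        then show "y \<in> g" using Tz zg g(3) by blast
      qed
      then have "card (ext T) \<le> 3" using g(1,2) card_mono le_trans by blast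
      then show False using T(1) unfolding triple_kernel_def by simp
    qed
    then show "T \<in> (\<lambda>z. {u, v, z}) ` g" using Tz by blast
  qed
  then show ?thesis using g(1,2) by (meson card_image_le card_mono finite_imageI le_trans)
next
  case False
  have "{T. triple_kernel T \<and> {u, v} \<subseteq> T} = {}"
  proof (rule ccontr)
    assume "{T. triple_kernel T \<and> {u, v} \<subseteq> T} \<noteq> {}"
    then obtain T where T: "triple_kernel T" "{u, v} \<subseteq> T" by blast
    then have "ext T \<noteq> {}" unfolding triple_kernel_def by auto
    then obtain y where "insert y T \<in> E" unfolding ext_def by blast
    moreover have "{u, v} \<subseteq> insert y T" using T(2) by auto
    ultimately show False using False by meson
  qed
  note empty = this
  show ?thesis unfolding empty by simp
qed

end

lemma card3_obtain:
  assumes "card T = 3" "u \<in> T" "v \<in> T" "u \<noteq> v"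
  obtains z where "T = {u, v, z}" "z \<noteq> u" "z \<noteq> v"
proof -
  have "finite T" using assms(1) card_ge_0_finite[of T] by simp
  then have "card (T - {u, v}) = 1" using assms by (simp add: card_Diff_subset)
  then obtain z where z: "T - {u, v} = {z}" by (meson card_1_singletonE)
  then show ?thesis using that[of z] assms by blast
qed

text \<open>Unless all triples share the pair common to two of them, a triple without that whole
  pair confines the family to four vertices, and these span only four triples.\<close>

lemma triples_meeting_in_pairs:
  assumes three: "\<And>T. T \<in> K \<Longrightarrow> card T = 3"
    and meet: "\<And>T T'. T \<in> K \<Longrightarrow> T' \<in> K \<Longrightarrow> T \<noteq> T' \<Longrightarrow> card (T \<inter> T') = 2"
    and fin: "finite K" and card: "card K > 4"
  shows "\<exists>u v. u \<noteq> v \<and> (\<forall>T\<in>K. u \<in> T \<and> v \<in> T)"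
proof -
  have "\<not> (\<exists>T. K \<subseteq> {T})"
  proof
    assume "\<exists>T. K \<subseteq> {T}"
    then obtain T where "K \<subseteq> {T}" by blast
    then have "card K \<le> card {T}" by (intro card_mono) auto
    then show False using card by simp
  qed
  then obtain T1 T2 where T12: "T1 \<in> K" "T2 \<in> K" "T1 \<noteq> T2" by blast
  then obtain u v where uv: "T1 \<inter> T2 = {u, v}" "u \<noteq> v" using meet by (metis card_2_iff)
  obtain a where a: "T1 = {u, v, a}" "a \<noteq> u" "a \<noteq> v"
    using card3_obtain[of T1 u v] three T12 uv by blast
  obtain b where b: "T2 = {u, v, b}" "b \<noteq> u" "b \<noteq> v"
    using card3_obtain[of T2 u v] three T12 uv by blast
  have ab: "a \<noteq> b" using a b T12 by blast
  have two: "\<exists>x y. x \<noteq> y \<and> x \<in> T \<and> x \<in> T' \<and> y \<in> T \<and> y \<in> T'" if "T \<in> K" "T' \<in> K" "T \<noteq> T'" for T T'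
    using meet[OF that] by (auto simp: card_2_iff)
  show ?thesis
  proof (cases "\<forall>T\<in>K. u \<in> T \<and> v \<in> T")
    case True then show ?thesis using uv(2) by blast
  next
    case False
    then obtain T3 where T3: "T3 \<in> K" "\<not> (u \<in> T3 \<and> v \<in> T3)" by blast
    \<comment> \<open>Such a triple shares two vertices with each of \<open>T1\<close> and
      \<open>T2\<close>, but not both u and v.\<close>
    have key: "a \<in> T \<and> b \<in> T \<and> (u \<in> T \<or> v \<in> T)" if "T \<in> K" "\<not> (u \<in> T \<and> v \<in> T)" for T
      using two[OF that(1) T12(1)] two[OF that(1) T12(2)] that a b by blast
    have inside: "T \<subseteq> {u, v, a, b}" if T: "T \<in> K" "\<not> (u \<in> T \<and> v \<in> T)" for T
    proof -
      have k: "a \<in> T" "b \<in> T" "u \<in> T \<or> v \<in> T" using key[OF T] by blast+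
      obtain z where "T = {a, b, z}" using card3_obtain[OF three[OF T(1)] k(1,2) ab] .
      then show ?thesis using k(3) a b by auto
    qed
    have "T \<subseteq> {u, v, a, b}" if T: "T \<in> K" for T
    proof (cases "u \<in> T \<and> v \<in> T")
      case True
      then obtain c where c: "T = {u, v, c}" using card3_obtain[OF three[OF T] _ _ uv(2)] by metis
      have "T \<noteq> T3" using True T3 by blast
      from two[OF T T3(1) this] have "c \<in> T3" using c T3(2) by auto
      then show ?thesis using c inside[OF T3] by blast
    next
      case False
      then show ?thesis using inside[OF T] by blast
    qed
    then have "K \<subseteq> {T. T \<subseteq> {u, v, a, b} \<and> card T = 3}" using three by blast
    then have "card K \<le> card {T. T \<subseteq> {u, v, a, b} \<and> card T = 3}" by (intro card_mono) auto
    also have "\<dots> = card {u, v, a, b} choose 3" by (rule n_subsets) simp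
    also have "card {u, v, a, b} = 4" using a b ab uv by auto
    finally show ?thesis using card by (simp add: numeral_eq_Suc)
  qed
qed

section \<open>Edges without kernels\<close>

lemma double_count:
  assumes "finite A" "finite X"
    and "\<And>e. e \<in> A \<Longrightarrow> e \<subseteq> X \<and> card e = c"
    and "\<And>v. v \<in> X \<Longrightarrow> card {e \<in> A. v \<in> e} \<le> d"
  shows "c * card A \<le> d * card X"
proof -
  have "(\<Sum>e\<in>A. card {v \<in> X. v \<in> e}) = (\<Sum>v\<in>X. card {e \<in> A. v \<in> e})"
    by (rule sum_multicount_gen) (use assms in auto)
  also have "(\<Sum>e\<in>A. card {v \<in> X. v \<in> e}) = (\<Sum>e\<in>A. c)"
  proof (rule sum.cong)
    fix e assume "e \<in> A"
    then have "{v \<in> X. v \<in> e} = e" "card e = c" using assms(3) by blast+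
    then show "card {v \<in> X. v \<in> e} = c" by simp
  qed simp
  finally have "c * card A = (\<Sum>v\<in>X. card {e \<in> A. v \<in> e})" by (simp add: mult.commute)
  also have "\<dots> \<le> (\<Sum>v\<in>X. d)" by (rule sum_mono) (rule assms(4))
  finally show ?thesis by (simp add: mult.commute)
qed

context single_free
begin

lemma card_edges_over_triple:
  assumes "card T = 3" "\<not> triple_kernel T"
  shows "card {e \<in> E. T \<subseteq> e} \<le> 3"
proof -
  have finT: "finite T" using assms(1) card_ge_0_finite[of T] by simp
  have "{e \<in> E. T \<subseteq> e} \<subseteq> (\<lambda>x. insert x T) ` ext T"
  proof
    fix e assume "e \<in> {e \<in> E. T \<subseteq> e}"
    then have e: "e \<in> E" "T \<subseteq> e" by auto
    then have "card (e - T) = 1" using card_edge[OF e(1)] assms(1) finT by (simp add: card_Diff_subset)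
    then obtain x where "e - T = {x}" by (meson card_1_singletonE)
    then have "e = insert x T" "x \<notin> T" using e(2) by blast+
    then show "e \<in> (\<lambda>x. insert x T) ` ext T" using e(1) unfolding ext_def by blast
  qed
  then have "card {e \<in> E. T \<subseteq> e} \<le> card (ext T)"
    using finite_ext by (meson card_image_le card_mono finite_imageI le_trans)
  then show ?thesis using assms unfolding triple_kernel_def by linarith
qed

lemma card_Union_le_three:
  assumes "finite g" "card g \<le> 3" "\<And>x. x \<in> g \<Longrightarrow> card (f x) \<le> d"
  shows "card (\<Union>x\<in>g. f x) \<le> 3 * d"
proof -
  have "card (\<Union>x\<in>g. f x) \<le> (\<Sum>x\<in>g. card (f x))" by (rule card_UN_le[OF assms(1)])
  also have "\<dots> \<le> card g * d" using sum_mono[of g "\<lambda>x. card (f x)" "\<lambda>_. d"] assms(3) by simp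
  also have "\<dots> \<le> 3 * d" using assms(2) by simp
  finally show ?thesis .
qed

text \<open>Each such edge is recorded as a vertex x together with a triple \<open>T\<close>. For
  fixed x, five triples would share a pair; that pair lies in an edge of \<open>F\<close>, so it is
  no kernel and lies in at most three triple kernels.\<close>

lemma card_edges_with_triple_kernel:
  assumes F: "F \<subseteq> E" and no: "\<And>e p. e \<in> F \<Longrightarrow> p \<subseteq> e \<Longrightarrow> \<not> kernel p"
  shows "card {e \<in> F. \<exists>T\<subseteq>e. triple_kernel T} \<le> 4 * card (\<Union>F)"
proof -
  define K where "K x = {T. triple_kernel T \<and> (x \<notin> T \<and> insert x T \<in> F)}" for x
  have finK: "finite (K x)" for x unfolding K_def by (rule finite_triple_kernels)
  have finU: "finite (\<Union>F)" using F edge_subset finite_V by (meson Sup_le_iff finite_subset subsetD)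
  have "card (K x) \<le> 4" for x
  proof (rule ccontr)
    assume "\<not> card (K x) \<le> 4"
    then have large: "card (K x) > 4" by simp
    have three: "card T = 3" if "T \<in> K x" for T using that unfolding K_def triple_kernel_def by simp
    \<comment> \<open>One common vertex contradicts \<open>triple_kernel_edge\<close>, none would
      make the two edges meet only in x, and three would make the triples equal.\<close>
    have meet: "card (T \<inter> T') = 2" if "T \<in> K x" "T' \<in> K x" "T \<noteq> T'" for T T'
    proof -
      have T: "triple_kernel T" "x \<notin> T" "insert x T \<in> E" and T': "x \<notin> T'" "insert x T' \<in> E"
        using that F unfolding K_def by auto
      have fin: "finite T" using three[OF that(1)] card_ge_0_finite[of T] by simp
      have "insert x T' \<inter> T = T \<inter> T'" using T(2) by blast
      then have "card (T \<inter> T') \<noteq> 1" using triple_kernel_edge[OF T(1) T'(2)] by simp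
      moreover have "insert x T \<inter> insert x T' = insert x (T \<inter> T')" by blast
      then have "card (insert x T \<inter> insert x T') = Suc (card (T \<inter> T'))" using T(2) fin by simp
      then have "card (T \<inter> T') \<noteq> 0" using card_Int_edges[OF T(3) T'(2)] by linarith
      moreover have "card (T \<inter> T') \<noteq> 3"
        using three[OF that(1)] three[OF that(2)] fin card_ge_0_finite[of T'] that(3)
        by (metis card_subset_eq inf_le1 inf_le2 zero_less_numeral)
      moreover have "card (T \<inter> T') \<le> 3"
        using three[OF that(1)] card_mono[OF fin, of "T \<inter> T'"] by simp
      ultimately show ?thesis by linarith
    qed
    have "\<exists>u v. u \<noteq> v \<and> (\<forall>T\<in>K x. u \<in> T \<and> v \<in> T)"
      by (rule triples_meeting_in_pairs[OF three meet finK large])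
    then obtain u v where uv: "u \<noteq> v" "\<And>T. T \<in> K x \<Longrightarrow> u \<in> T \<and> v \<in> T" by blast
    have "K x \<noteq> {}" using large by auto
    then obtain T where T: "T \<in> K x" by blast
    then have "insert x T \<in> F" "{u, v} \<subseteq> insert x T" using uv(2) unfolding K_def by auto
    then have nk: "\<not> kernel {u, v}" using no by simp
    have "card (K x) \<le> card {T. triple_kernel T \<and> {u, v} \<subseteq> T}"
    proof (rule card_mono[OF finite_triple_kernels])
      show "K x \<subseteq> {T. triple_kernel T \<and> {u, v} \<subseteq> T}" using uv(2) unfolding K_def by auto
    qed
    then show False using card_triple_kernels_over_pair[OF nk uv(1)] large by linarith
  qed
  note K4 = this
  have "{e \<in> F. \<exists>T\<subseteq>e. triple_kernel T} \<subseteq> (\<lambda>(x, T). insert x T) ` (SIGMA x:\<Union>F. K x)"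
  proof
    fix e assume "e \<in> {e \<in> F. \<exists>T\<subseteq>e. triple_kernel T}"
    then obtain T where e: "e \<in> F" "e \<in> E" and T: "T \<subseteq> e" "triple_kernel T" using F by auto
    have "card T = 3" using T(2) unfolding triple_kernel_def by simp
    then have "card (e - T) = 1" using card_edge[OF e(2)] T(1) finite_edge[OF e(2)]
      by (simp add: card_Diff_subset finite_subset)
    then obtain x where "e - T = {x}" by (meson card_1_singletonE)
    then have x: "e = insert x T" "x \<notin> T" using T(1) by blast+
    then have "T \<in> K x" "x \<in> \<Union>F" using e(1) T(2) unfolding K_def by auto
    then show "e \<in> (\<lambda>(x, T). insert x T) ` (SIGMA x:\<Union>F. K x)" using x(1) by force
  qed
  then have "card {e \<in> F. \<exists>T\<subseteq>e. triple_kernel T} \<le> card (SIGMA x:\<Union>F. K x)"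
    using finU finK by (meson card_image_le card_mono finite_SigmaI finite_imageI le_trans)
  also have "\<dots> = (\<Sum>x\<in>\<Union>F. card (K x))" using finU finK by (intro card_SigmaI) auto
  also have "\<dots> \<le> (\<Sum>x\<in>\<Union>F. 4)" by (rule sum_mono) (rule K4)
  finally show ?thesis by (simp add: mult.commute)
qed

text \<open>Every degree is at most 3 * 3 * 3. An edge through v meets \<open>e0\<close> in one of
  three further vertices a, then meets the cover of {v, a} in one of at most three vertices, and the
  triple obtained has at most three extensions.\<close>

lemma card_edges_without_triple_kernel:
  assumes F: "F \<subseteq> E" and no: "\<And>e p. e \<in> F \<Longrightarrow> p \<subseteq> e \<Longrightarrow> \<not> kernel p"
    and no3: "\<And>e T. e \<in> F \<Longrightarrow> T \<subseteq> e \<Longrightarrow> \<not> triple_kernel T"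
  shows "4 * card F \<le> 27 * card (\<Union>F)"
proof (rule double_count)
  show finF: "finite F" using F finite_E finite_subset by blast
  show "finite (\<Union>F)" using F edge_subset finite_V by (meson Sup_le_iff finite_subset subsetD)
  show "e \<subseteq> \<Union>F \<and> card e = 4" if "e \<in> F" for e using that F card_edge by blast
  fix v assume "v \<in> \<Union>F"
  then obtain e0 where e0: "e0 \<in> F" "v \<in> e0" by blast
  have e0E: "e0 \<in> E" using e0 F by blast
  define L where "L a = {e \<in> F. {v, a} \<subseteq> e}" for a
  have L9: "card (L a) \<le> 9" if a: "a \<in> e0 - {v}" for a
  proof -
    have "\<not> kernel {v, a}" using no[OF e0(1)] a e0 by simp
    moreover have "v \<noteq> a" "{v, a} \<subseteq> e0" using a e0 by auto
    ultimately obtain g where g: "finite g" "card g \<le> 3" "g \<inter> {v, a} = {}"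
        "\<And>e. e \<in> E \<Longrightarrow> {v, a} \<subseteq> e \<Longrightarrow> e \<inter> g \<noteq> {}"
      using non_kernel_cover[OF _ _ e0E] by metis
    define M where "M x = {e \<in> F. {v, a, x} \<subseteq> e}" for x
    have M3: "card (M x) \<le> 3" if x: "x \<in> g" for x
    proof (cases "M x = {}")
      case False
      then obtain e1 where e1: "e1 \<in> F" "{v, a, x} \<subseteq> e1" unfolding M_def by blast
      have "card {v, a, x} = 3" using x g(3) \<open>v \<noteq> a\<close> by (auto simp: card_insert_if)
      then have "card {e \<in> E. {v, a, x} \<subseteq> e} \<le> 3" using card_edges_over_triple no3[OF e1] by blast
      moreover have "card (M x) \<le> card {e \<in> E. {v, a, x} \<subseteq> e}"
        using F finite_E unfolding M_def by (intro card_mono) auto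
      ultimately show ?thesis by linarith
    qed simp
    have "L a \<subseteq> (\<Union>x\<in>g. M x)"
    proof
      fix e assume e: "e \<in> L a"
      then have e': "e \<in> F" "e \<in> E" "{v, a} \<subseteq> e" using F unfolding L_def by auto
      then obtain x where "x \<in> e" "x \<in> g" using g(4) by blast
      then show "e \<in> (\<Union>x\<in>g. M x)" using e' unfolding M_def by auto
    qed
    moreover have "finite (\<Union>x\<in>g. M x)" using finF g(1) unfolding M_def by simp
    ultimately have "card (L a) \<le> card (\<Union>x\<in>g. M x)" by (intro card_mono)
    then show ?thesis using card_Union_le_three[of g M 3] g(1,2) M3 by simp
  qed
  have c3: "card (e0 - {v}) = 3" using card_edge[OF e0E] e0(2) by (simp add: card_Diff_singleton)
  have f3: "finite (e0 - {v})" using finite_edge[OF e0E] by simp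
  have "{e \<in> F. v \<in> e} \<subseteq> (\<Union>a\<in>e0 - {v}. L a)"
  proof
    fix e assume "e \<in> {e \<in> F. v \<in> e}"
    then have e: "e \<in> F" "v \<in> e" "e \<in> E" using F by auto
    obtain a where "a \<noteq> v" "a \<in> e" "a \<in> e0" using edges_meet_again[OF e(3) e0E e(2) e0(2)] by blast
    then show "e \<in> (\<Union>a\<in>e0 - {v}. L a)" using e unfolding L_def by auto
  qed
  moreover have "finite (\<Union>a\<in>e0 - {v}. L a)" using finF f3 unfolding L_def by simp
  ultimately have "card {e \<in> F. v \<in> e} \<le> card (\<Union>a\<in>e0 - {v}. L a)" by (intro card_mono)
  then show "card {e \<in> F. v \<in> e} \<le> 27"
    using card_Union_le_three[of "e0 - {v}" L 9] f3 L9 c3 by simp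
qed

lemma card_edges_without_kernel:
  assumes F: "F \<subseteq> E" and no: "\<And>e p. e \<in> F \<Longrightarrow> p \<subseteq> e \<Longrightarrow> \<not> kernel p"
  shows "4 * card F \<le> 43 * card (\<Union>F)"
proof -
  define A where "A = {e \<in> F. \<exists>T\<subseteq>e. triple_kernel T}"
  have fin: "finite F" using F finite_E finite_subset by blast
  have finU: "finite (\<Union>F)" using F edge_subset finite_V by (meson Sup_le_iff finite_subset subsetD)
  have "4 * card (F - A) \<le> 27 * card (\<Union>(F - A))"
  proof (rule card_edges_without_triple_kernel)
    show "F - A \<subseteq> E" using F by blast
    show "\<not> kernel p" if "e \<in> F - A" "p \<subseteq> e" for e p using no that by blast
    show "\<not> triple_kernel T" if "e \<in> F - A" "T \<subseteq> e" for e T using that unfolding A_def by blast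
  qed
  also have "card (\<Union>(F - A)) \<le> card (\<Union>F)" using finU by (intro card_mono) auto
  finally have "4 * card (F - A) \<le> 27 * card (\<Union>F)" by simp
  moreover have "card A \<le> 4 * card (\<Union>F)"
    unfolding A_def by (rule card_edges_with_triple_kernel[OF F no])
  moreover have "card F = card A + card (F - A)"
    using fin card_Diff_subset[of A F] card_mono[of F A] unfolding A_def by simp
  ultimately show ?thesis by linarith
qed

end

section \<open>Decomposition into kernels, stars and junk\<close>

context single_free
begin

definition "kernels = {p. kernel p}"
definition "rest = V - \<Union>kernels"
definition "link p = {s. card s = 2 \<and> s \<subseteq> rest \<and> p \<union> s \<in> E}"
definition "free_edges = {e \<in> E. e \<subseteq> rest}"
text \<open>These vertices would belong to several stars at once. Together with the vertices of
  kernel-free edges they are kept out of the leaf sets, which makes the stars disjoint.\<close>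

definition "shared = {x. \<exists>p\<in>kernels. \<exists>q\<in>kernels. \<exists>s\<in>link p. \<exists>s'\<in>link q. p \<noteq> q \<and> x \<in> s \<and> x \<in> s'}"
definition "core = \<Union>free_edges \<union> shared"
definition "leaves p = {x. x \<notin> core \<and> (\<exists>s\<in>link p. x \<in> s)}"
definition "star p = {p \<union> s |s. s \<in> link p \<and> s \<subseteq> leaves p}"
definition "core_links = {(p, s). p \<in> kernels \<and> s \<in> link p \<and> s \<subseteq> core}"
definition "junk = free_edges \<union> (\<lambda>(p, s). p \<union> s) ` core_links"

lemma kernels_subset: "p \<in> kernels \<Longrightarrow> p \<subseteq> V"
  unfolding kernels_def kernel_def using edge_subset by blast

lemma finite_kernels: "finite kernels"
  by (rule finite_subset[of _ "Pow V"]) (use kernels_subset finite_V in auto)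

lemma card_kernel: "p \<in> kernels \<Longrightarrow> card p = 2"
  unfolding kernels_def kernel_def by blast

lemma finite_kernel: "p \<in> kernels \<Longrightarrow> finite p"
  using card_kernel[of p] card_ge_0_finite[of p] by simp

lemma kernels_disjoint: "p \<in> kernels \<Longrightarrow> q \<in> kernels \<Longrightarrow> p \<noteq> q \<Longrightarrow> p \<inter> q = {}"
  unfolding kernels_def using kernel_disjoint by blast

lemma rest_kernel: "s \<subseteq> rest \<Longrightarrow> p \<in> kernels \<Longrightarrow> s \<inter> p = {}"
  unfolding rest_def by blast

lemma linkD:
  assumes "s \<in> link p"
  shows "card s = 2" "finite s" "s \<subseteq> rest" "p \<union> s \<in> E"
proof -
  show *: "card s = 2" and "s \<subseteq> rest" and "p \<union> s \<in> E" using assms unfolding link_def by simp_all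
  show "finite s" using * card_ge_0_finite[of s] by simp
qed

lemma not_kernel_rest:
  assumes "s \<subseteq> rest" shows "\<not> kernel s"
proof
  assume "kernel s"
  then have "s \<in> kernels" "s \<noteq> {}" unfolding kernels_def kernel_def by auto
  then show False using rest_kernel[OF assms] by blast
qed

text \<open>Kernels are disjoint from each other and from \<open>rest\<close>, so the two edges meet
  exactly where the link pairs do, and this cannot be a single vertex.\<close>

lemma links_eq:
  assumes p: "p \<in> kernels" "q \<in> kernels" "p \<noteq> q" and s: "s \<in> link p" "s' \<in> link q" and x: "x \<in> s" "x \<in> s'"
  shows "s = s'"
proof -
  have "(p \<union> s) \<inter> (q \<union> s') = s \<inter> s'"
    using kernels_disjoint[OF p] rest_kernel[OF linkD(3)[OF s(1)] p(2)] rest_kernel[OF linkD(3)[OF s(2)] p(1)] by blast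
  then have "card (s \<inter> s') \<noteq> 1" using card_Int_edges[OF linkD(4)[OF s(1)] linkD(4)[OF s(2)]] by simp
  then have "s \<subseteq> s'" using card_two_Int_cases[OF linkD(1)[OF s(1)]] x by blast
  then show ?thesis using linkD(1,2)[OF s(1)] linkD(1,2)[OF s(2)] by (simp add: card_subset_eq)
qed

lemma link_free_edge:
  assumes p: "p \<in> kernels" and s: "s \<in> link p" and e: "e \<in> free_edges" and x: "x \<in> s" "x \<in> e"
  shows "s \<subseteq> e"
proof -
  have e': "e \<in> E" "e \<subseteq> rest" using e unfolding free_edges_def by auto
  have "(p \<union> s) \<inter> e = s \<inter> e" using rest_kernel[OF e'(2) p] by blast
  then have "card (s \<inter> e) \<noteq> 1" using card_Int_edges[OF linkD(4)[OF s] e'(1)] by simp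
  then show ?thesis using card_two_Int_cases[OF linkD(1)[OF s]] x by blast
qed

text \<open>A link pair through a shared vertex is also a link pair of another kernel, and one
  touching a free edge lies inside that edge. Hence no link pair is split between core and
  leaves.\<close>

lemma link_core:
  assumes p: "p \<in> kernels" and s: "s \<in> link p" and x: "x \<in> s" "x \<in> core"
  shows "s \<subseteq> core"
proof (cases "x \<in> shared")
  case False
  then obtain e where e: "e \<in> free_edges" "x \<in> e" using x(2) unfolding core_def by blast
  then have "s \<subseteq> e" using link_free_edge[OF p s e(1) x(1)] by simp
  then show ?thesis using e unfolding core_def by blast
next
  case True
  then obtain q q' t t' where q: "q \<in> kernels" "q' \<in> kernels" "t \<in> link q" "t' \<in> link q'" "q \<noteq> q'" "x \<in> t" "x \<in> t'"
    unfolding shared_def by blast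
  obtain r v where r: "r \<in> kernels" "r \<noteq> p" "v \<in> link r" "x \<in> v"
  proof (cases "q = p")
    case True
    then show ?thesis using that[of q' t'] q by simp
  next
    case False
    then show ?thesis using that[of q t] q by simp
  qed
  then have "s = v" using links_eq[OF p r(1) _ s r(3) x(1) r(4)] by simp
  then have "s \<subseteq> shared" using p s r unfolding shared_def by blast
  then show ?thesis unfolding core_def by blast
qed

lemma core_subset: "core \<subseteq> rest"
  unfolding core_def shared_def free_edges_def using linkD(3) by blast

lemma leaves_subset: "leaves p \<subseteq> rest - core"
  unfolding leaves_def using linkD(3) by blast

lemma finite_rest: "finite rest"
  using finite_V unfolding rest_def by simp

lemma finite_core: "finite core"
  using core_subset finite_rest finite_subset by blast

lemma finite_leaves: "finite (leaves p)"
  using leaves_subset finite_rest finite_subset by blast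

lemma leaves_disjoint:
  "p \<in> kernels \<Longrightarrow> q \<in> kernels \<Longrightarrow> p \<noteq> q \<Longrightarrow> leaves p \<inter> leaves q = {}"
proof (rule ccontr)
  assume pq: "p \<in> kernels" "q \<in> kernels" "p \<noteq> q" and "leaves p \<inter> leaves q \<noteq> {}"
  then obtain x where x: "x \<in> leaves p" "x \<in> leaves q" by blast
  then obtain s s' where "s \<in> link p" "s' \<in> link q" "x \<in> s" "x \<in> s'" "x \<notin> core"
    unfolding leaves_def by blast
  moreover then have "x \<in> shared" using pq unfolding shared_def by blast
  ultimately show False unfolding core_def by blast
qed

lemma link_leaves:
  assumes "p \<in> kernels" "s \<in> link p" "\<not> s \<subseteq> core"
  shows "s \<subseteq> leaves p"
proof
  fix x assume x: "x \<in> s"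
  then have "x \<notin> core" using link_core[OF assms(1,2) x] assms(3) by blast
  then show "x \<in> leaves p" using x assms(2) unfolding leaves_def by blast
qed

text \<open>A link pair that supplies one leaf supplies two. This decides the case where kernels
  cover all vertices but one.\<close>

lemma card_leaves: "p \<in> kernels \<Longrightarrow> card (leaves p) \<noteq> 1"
proof
  assume p: "p \<in> kernels" and "card (leaves p) = 1"
  then obtain x where x: "leaves p = {x}" by (meson card_1_singletonE)
  then obtain s where s: "s \<in> link p" "x \<in> s" "x \<notin> core" unfolding leaves_def by blast
  then have "s \<subseteq> {x}" using link_leaves[OF p s(1)] x by blast
  then have "card s \<le> 1" by (metis card_mono finite.emptyI finite_insert is_singletonI is_singleton_altdef)
  then show False using linkD(1)[OF s(1)] by simp
qed

lemma star_subset: "star p \<subseteq> E"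
  unfolding star_def using linkD(4) by blast

lemma card_star: "card (star p) \<le> card (leaves p) choose 2"
proof -
  have "star p \<subseteq> (\<lambda>s. p \<union> s) ` {s. s \<subseteq> leaves p \<and> card s = 2}"
    unfolding star_def using linkD(1) by blast
  then have "card (star p) \<le> card {s. s \<subseteq> leaves p \<and> card s = 2}"
    using finite_leaves[of p] by (intro surj_card_le) auto
  then show ?thesis using n_subsets[OF finite_leaves] by simp
qed

lemma finite_core_links: "finite core_links"
proof (rule finite_subset)
  show "core_links \<subseteq> kernels \<times> Pow core" unfolding core_links_def by blast
qed (simp add: finite_kernels finite_core)

text \<open>At a shared vertex all link pairs coincide, and four kernels linked to the same pair
  would turn it into a kernel by \<open>kernelI_four\<close>. At any other core vertex only one
  kernel is linked, by pairs inside a single free edge, which leaves three choices for the second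
  vertex.\<close>

lemma card_links_at:
  assumes x: "x \<in> core"
  shows "card {ps \<in> core_links. x \<in> snd ps} \<le> 3"
proof (cases "x \<in> shared")
  case True
  then obtain q q' t t' where q: "q \<in> kernels" "q' \<in> kernels" "t \<in> link q" "t' \<in> link q'" "q \<noteq> q'" "x \<in> t" "x \<in> t'"
    unfolding shared_def by blast
  have tt: "t = t'" using links_eq[OF q(1,2,5,3,4,6,7)] .
  have all: "s = t" if "p \<in> kernels" "s \<in> link p" "x \<in> s" for p s
  proof (cases "p = q")
    case True
    then show ?thesis using links_eq[OF that(1) q(2) _ that(2) q(4) that(3) q(7)] q(5) tt by simp
  next
    case False
    then show ?thesis using links_eq[OF that(1) q(1) _ that(2) q(3) that(3) q(6)] by simp
  qed
  define Q where "Q = {p \<in> kernels. t \<in> link p}"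
  have finQ: "finite Q" unfolding Q_def using finite_kernels by simp
  have tQ: "t \<inter> p = {}" if "p \<in> Q" for p
    using that rest_kernel[OF linkD(3)[OF q(3)]] unfolding Q_def by blast
  have "card Q \<le> 3"
  proof (rule ccontr)
    assume c: "\<not> card Q \<le> 3"
    have "kernel t"
    proof (rule kernelI_four[OF linkD(1)[OF q(3)], of "(\<lambda>p. p \<union> t) ` Q"])
      show "(\<lambda>p. p \<union> t) ` Q \<subseteq> E" unfolding Q_def using linkD(4) by blast
      have "inj_on (\<lambda>p. p \<union> t) Q"
      proof (rule inj_onI)
        fix p p' assume p: "p \<in> Q" "p' \<in> Q" "p \<union> t = p' \<union> t"
        show "p = p'" using tQ[OF p(1)] tQ[OF p(2)] p(3) by blast
      qed
      then show "4 \<le> card ((\<lambda>p. p \<union> t) ` Q)" using c by (simp add: card_image)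
      fix e e' assume "e \<in> (\<lambda>p. p \<union> t) ` Q" "e' \<in> (\<lambda>p. p \<union> t) ` Q" "e \<noteq> e'"
      then obtain p p' where p: "p \<in> Q" "p' \<in> Q" "e = p \<union> t" "e' = p' \<union> t" "p \<noteq> p'" by blast
      then have "p \<inter> p' = {}" using kernels_disjoint unfolding Q_def by blast
      then show "e \<inter> e' = t" using p by blast
    qed
    then show False using not_kernel_rest[OF linkD(3)[OF q(3)]] by blast
  qed
  moreover have "{ps \<in> core_links. x \<in> snd ps} \<subseteq> (\<lambda>p. (p, t)) ` Q"
  proof
    fix ps assume "ps \<in> {ps \<in> core_links. x \<in> snd ps}"
    then obtain p s where ps: "ps = (p, s)" "p \<in> kernels" "s \<in> link p" "x \<in> s"
      unfolding core_links_def by auto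
    then show "ps \<in> (\<lambda>p. (p, t)) ` Q" using all[OF ps(2-4)] unfolding Q_def by auto
  qed
  ultimately show ?thesis using finQ by (meson surj_card_le le_trans)
next
  case False
  then obtain e where e: "e \<in> free_edges" "x \<in> e" using x unfolding core_def by blast
  have eE: "e \<in> E" using e unfolding free_edges_def by blast
  show ?thesis
  proof (cases "{ps \<in> core_links. x \<in> snd ps} = {}")
    case False
    then obtain p s where p: "p \<in> kernels" "s \<in> link p" "x \<in> s" unfolding core_links_def by auto
    have "{ps \<in> core_links. x \<in> snd ps} \<subseteq> (\<lambda>y. (p, {x, y})) ` (e - {x})"
    proof
      fix qt assume "qt \<in> {ps \<in> core_links. x \<in> snd ps}"
      then obtain q t where q: "qt = (q, t)" "q \<in> kernels" "t \<in> link q" "x \<in> t"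
        unfolding core_links_def by auto
      have "q = p" using q p \<open>x \<notin> shared\<close> unfolding shared_def by blast
      obtain a b where ab: "t = {a, b}" "a \<noteq> b" using linkD(1)[OF q(3)] by (meson card_2_iff)
      have "t \<subseteq> e" using link_free_edge[OF q(2,3) e(1) q(4) e(2)] .
      then obtain y where "t = {x, y}" "y \<in> e - {x}" using ab q(4) by blast
      then show "qt \<in> (\<lambda>y. (p, {x, y})) ` (e - {x})" using q(1) \<open>q = p\<close> by blast
    qed
    then have "card {ps \<in> core_links. x \<in> snd ps} \<le> card (e - {x})"
      using finite_edge[OF eE] by (intro surj_card_le) auto
    also have "\<dots> = 3" using card_edge[OF eE] e(2) by (simp add: card_Diff_singleton)
    finally show ?thesis .
  next
    case True
    show ?thesis unfolding True by simp
  qed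
qed

lemma card_core_links: "2 * card core_links \<le> 3 * card core"
proof -
  have "(\<Sum>ps\<in>core_links. card {x \<in> core. x \<in> snd ps}) = (\<Sum>x\<in>core. card {ps \<in> core_links. x \<in> snd ps})"
    by (rule sum_multicount_gen) (use finite_core_links finite_core in auto)
  also have "(\<Sum>ps\<in>core_links. card {x \<in> core. x \<in> snd ps}) = (\<Sum>ps\<in>core_links. 2)"
  proof (rule sum.cong)
    fix ps assume "ps \<in> core_links"
    then have "{x \<in> core. x \<in> snd ps} = snd ps" "card (snd ps) = 2"
      unfolding core_links_def using linkD(1) by auto
    then show "card {x \<in> core. x \<in> snd ps} = 2" by simp
  qed simp
  also have "(\<Sum>x\<in>core. card {ps \<in> core_links. x \<in> snd ps}) \<le> (\<Sum>x\<in>core. 3)"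
    by (rule sum_mono) (rule card_links_at)
  finally show ?thesis by (simp add: mult.commute)
qed

lemma card_junk: "4 * card junk \<le> 49 * card core"
proof -
  have "4 * card free_edges \<le> 43 * card (\<Union>free_edges)"
  proof (rule card_edges_without_kernel)
    show "free_edges \<subseteq> E" unfolding free_edges_def by blast
    show "\<not> kernel p" if "e \<in> free_edges" "p \<subseteq> e" for e p
      using that not_kernel_rest[of p] unfolding free_edges_def by blast
  qed
  moreover have "card (\<Union>free_edges) \<le> card core"
    using finite_core by (intro card_mono) (auto simp: core_def)
  moreover have "card junk \<le> card free_edges + card core_links"
    unfolding junk_def
    by (rule order_trans[OF card_Un_le]) (simp add: card_image_le finite_core_links)
  ultimately show ?thesis using card_core_links by linarith
qed

text \<open>The linear bound on \<open>junk\<close> does not exclude junk when there is a single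
  core vertex, but for odd order a maximal set of kernels leaves one vertex over.\<close>

lemma junk_empty:
  assumes "card core \<le> 1" shows "junk = {}"
proof -
  have "card s \<le> 1" if "s \<subseteq> core" for s
    using card_mono[OF finite_core that] assms by linarith
  then have "core_links = {}" unfolding core_links_def using linkD(1) by (metis (mono_tags, lifting) Collect_empty_eq Suc_1 case_prodE not_less_eq_eq order_refl)
  moreover have "free_edges = {}"
  proof (rule ccontr)
    assume "free_edges \<noteq> {}"
    then obtain e where e: "e \<in> free_edges" by blast
    then have "e \<subseteq> core" "e \<in> E" unfolding core_def free_edges_def by auto
    then show False using card_edge[of e] card_mono[OF finite_core, of e] assms by simp
  qed
  ultimately show ?thesis unfolding junk_def by simp
qed

lemma edges_decomposition:
  "E \<subseteq> {p \<union> q |p q. p \<in> kernels \<and> q \<in> kernels \<and> p \<noteq> q} \<union> junk \<union> (\<Union>p\<in>kernels. star p)"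
proof
  fix e assume e: "e \<in> E"
  show "e \<in> {p \<union> q |p q. p \<in> kernels \<and> q \<in> kernels \<and> p \<noteq> q} \<union> junk \<union> (\<Union>p\<in>kernels. star p)"
  proof (cases "e \<subseteq> rest")
    case True
    then show ?thesis using e unfolding junk_def free_edges_def by blast
  next
    case False
    then obtain p where p: "p \<in> kernels" "p \<inter> e \<noteq> {}" using edge_subset[OF e] unfolding rest_def by blast
    have sub: "q \<subseteq> e" if "q \<in> kernels" "q \<inter> e \<noteq> {}" for q
      using kernel_edge[of q e] that e unfolding kernels_def by blast
    have pe: "p \<subseteq> e" using sub p by blast
    define s where "s = e - p"
    have c: "card s = 2" unfolding s_def
      using card_edge[OF e] card_kernel[OF p(1)] finite_kernel[OF p(1)] pe by (simp add: card_Diff_subset)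
    have es: "e = p \<union> s" unfolding s_def using pe by blast
    show ?thesis
    proof (cases "s \<subseteq> rest")
      case True
      then have s: "s \<in> link p" using c es e unfolding link_def by simp
      show ?thesis
      proof (cases "s \<subseteq> core")
        case True
        then have "(p, s) \<in> core_links" using s p unfolding core_links_def by blast
        then show ?thesis using es unfolding junk_def by force
      next
        case False
        then have "e \<in> star p" using s es link_leaves[OF p(1) s] unfolding star_def by blast
        then show ?thesis using p by blast
      qed
    next
      case False
      then obtain y q where q: "y \<in> s" "q \<in> kernels" "y \<in> q"
        using edge_subset[OF e] unfolding rest_def s_def by blast
      have "q \<noteq> p" using q unfolding s_def by blast
      moreover have "q \<subseteq> e" using sub q unfolding s_def by blast
      ultimately have "q \<subseteq> s" using kernels_disjoint[OF q(2) p(1)] unfolding s_def by blast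
      then have "q = s" using card_kernel[OF q(2)] c card_ge_0_finite[of s] by (simp add: card_subset_eq)
      then show ?thesis using es p(1) q(2) \<open>q \<noteq> p\<close> by blast
    qed
  qed
qed

lemma card_vertices:
  "2 * card kernels + (\<Sum>p\<in>kernels. card (leaves p)) + card (rest - (\<Union>p\<in>kernels. leaves p)) = card V"
proof -
  have "card (\<Union>kernels) = (\<Sum>p\<in>kernels. card p)"
    by (rule card_Union_disjoint)
       (use kernels_disjoint finite_kernel in \<open>auto simp: pairwise_def disjnt_def\<close>)
  also have "\<dots> = 2 * card kernels" using card_kernel by simp
  finally have 1: "card (\<Union>kernels) = 2 * card kernels" .
  have 2: "card (\<Union>p\<in>kernels. leaves p) = (\<Sum>p\<in>kernels. card (leaves p))"
    by (rule card_UN_disjoint) (use finite_kernels finite_leaves leaves_disjoint in auto)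
  have "(\<Union>p\<in>kernels. leaves p) \<subseteq> rest" using leaves_subset by blast
  then have 3: "card (rest - (\<Union>p\<in>kernels. leaves p)) + card (\<Union>p\<in>kernels. leaves p) = card rest"
    using finite_rest by (metis card_Diff_subset card_mono finite_subset le_add_diff_inverse2)
  have sub: "\<Union>kernels \<subseteq> V" using kernels_subset by blast
  then have "card rest + card (\<Union>kernels) = card V"
    unfolding rest_def using finite_V by (metis card_Diff_subset card_mono finite_subset le_add_diff_inverse2)
  then show ?thesis using 1 2 3 by linarith
qed

end

section \<open>The decomposition as an interface for counting\<close>

definition pair_unions :: "'a set set \<Rightarrow> 'a set set" where
  "pair_unions P = {p \<union> q |p q. p \<in> P \<and> q \<in> P \<and> p \<noteq> q}"

lemma card_pair_unions: "finite P \<Longrightarrow> card (pair_unions P) \<le> card P choose 2"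
proof -
  assume fin: "finite P"
  have "pair_unions P \<subseteq> Union ` {X. X \<subseteq> P \<and> card X = 2}"
  proof
    fix e assume "e \<in> pair_unions P"
    then obtain p q where "e = p \<union> q" "p \<in> P" "q \<in> P" "p \<noteq> q" unfolding pair_unions_def by blast
    then have "e = \<Union>{p, q}" "{p, q} \<in> {X. X \<subseteq> P \<and> card X = 2}" by simp_all
    then show "e \<in> Union ` {X. X \<subseteq> P \<and> card X = 2}" by (rule image_eqI)
  qed
  then have "card (pair_unions P) \<le> card {X. X \<subseteq> P \<and> card X = 2}"
    using fin by (intro surj_card_le) auto
  then show ?thesis using n_subsets[OF fin] by simp
qed

lemma degree_le_max_degree:
  assumes "four_graph H" "v \<in> verts H"
  shows "degree H v \<le> max_degree H"
proof -
  have "finite (insert 0 (degree H ` verts H))" using assms(1) unfolding four_graph_def by simp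
  then show ?thesis unfolding max_degree_def using assms(2) by (intro Max_ge) simp_all
qed

lemma finite_edges: "four_graph H \<Longrightarrow> finite (edges H)"
  unfolding four_graph_def by (meson PowI finite_Pow_iff finite_subset subsetI)

text \<open>Centres \<open>P\<close>, leaf sets \<open>L\<close>, star edges \<open>S\<close>,
  leftover edges \<open>J\<close> and the number \<open>w\<close> of remaining vertices. The
  counting arguments use only these data and no further information on how edges intersect.\<close>

locale star_decomposition =
  fixes H :: "'a hypergraph" and P :: "'a set set" and L :: "'a set \<Rightarrow> 'a set"
    and S :: "'a set \<Rightarrow> 'a set set" and J :: "'a set set" and w :: nat
  assumes four_graph: "four_graph H"
    and finite_P: "finite P" and pair: "p \<in> P \<Longrightarrow> card p = 2 \<and> p \<subseteq> verts H" and disjoint_P: "disjoint P"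
    and edges: "edges H \<subseteq> pair_unions P \<union> J \<union> (\<Union>p\<in>P. S p)"
    and finite_J: "finite J" and card_J: "4 * card J \<le> 49 * w" and J_empty: "w \<le> 1 \<Longrightarrow> J = {}"
    and L_subset: "p \<in> P \<Longrightarrow> L p \<subseteq> verts H - \<Union>P"
    and L_disjoint: "p \<in> P \<Longrightarrow> q \<in> P \<Longrightarrow> p \<noteq> q \<Longrightarrow> L p \<inter> L q = {}"
    and L_ne_1: "p \<in> P \<Longrightarrow> card (L p) \<noteq> 1"
    and S_subset: "p \<in> P \<Longrightarrow> S p \<subseteq> edges H"
    and S_star: "p \<in> P \<Longrightarrow> e \<in> S p \<Longrightarrow> p \<subseteq> e \<and> e \<subseteq> p \<union> L p"
    and card_S: "p \<in> P \<Longrightarrow> card (S p) \<le> card (L p) choose 2"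
    and card_S_degree: "p \<in> P \<Longrightarrow> card (S p) \<le> max_degree H"
    and total: "2 * card P + (\<Sum>p\<in>P. card (L p)) + w = card (verts H)"

lemma star_decomposition_exists:
  assumes H: "four_graph H" "P42_free H"
  shows "\<exists>P L S J w. star_decomposition H P L S J w"
proof -
  interpret single_free "verts H" "edges H"
  proof
    show "finite (verts H)" using H(1) unfolding four_graph_def by simp
    show "e \<subseteq> verts H" and "card e = 4" if "e \<in> edges H" for e
      using H(1) that unfolding four_graph_def by simp_all
    show "card (e \<inter> e') \<noteq> 1" if "e \<in> edges H" "e' \<in> edges H" for e e'
      using H(2) that unfolding P42_free_def by blast
  qed
  \<comment> \<open>Besides the core, \<open>w\<close> counts the vertices in no edge, so that the
    vertex count is an equation.\<close>
  define w where "w = card (rest - (\<Union>p\<in>kernels. leaves p))"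
  have "core \<subseteq> rest - (\<Union>p\<in>kernels. leaves p)" using core_subset leaves_subset by blast
  then have core: "card core \<le> w" unfolding w_def using finite_rest by (intro card_mono) auto
  have "star_decomposition H kernels leaves star junk w"
  proof
    show "four_graph H" by (rule H(1))
    show "finite kernels" by (rule finite_kernels)
    show "card p = 2 \<and> p \<subseteq> verts H" if "p \<in> kernels" for p
      using that card_kernel kernels_subset by blast
    show "disjoint kernels" using kernels_disjoint unfolding disjoint_def by blast
    show "edges H \<subseteq> pair_unions kernels \<union> junk \<union> (\<Union>p\<in>kernels. star p)"
      unfolding pair_unions_def by (rule edges_decomposition)
    show "finite junk" unfolding junk_def free_edges_def using finite_E finite_core_links by simp
    show "4 * card junk \<le> 49 * w" using card_junk core by linarith
    show "junk = {}" if "w \<le> 1" using that core junk_empty by linarith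
    show "leaves p \<subseteq> verts H - \<Union>kernels" for p using leaves_subset unfolding rest_def by blast
    show "leaves p \<inter> leaves q = {}" if "p \<in> kernels" "q \<in> kernels" "p \<noteq> q" for p q
      using leaves_disjoint that by blast
    show "card (leaves p) \<noteq> 1" if "p \<in> kernels" for p using card_leaves that by blast
    show "star p \<subseteq> edges H" for p by (rule star_subset)
    show "p \<subseteq> e \<and> e \<subseteq> p \<union> leaves p" if "e \<in> star p" for p e using that unfolding star_def by blast
    show "card (star p) \<le> card (leaves p) choose 2" for p by (rule card_star)
    show "card (star p) \<le> max_degree H" if p: "p \<in> kernels" for p
    proof -
      obtain v where v: "v \<in> p" using card_kernel[OF p] by fastforce
      then have "star p \<subseteq> {e \<in> edges H. v \<in> e}" using star_subset unfolding star_def by blast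
      then have "card (star p) \<le> degree H v" unfolding degree_def using finite_E by (intro card_mono) auto
      also have "\<dots> \<le> max_degree H" using degree_le_max_degree[OF H(1)] kernels_subset[OF p] v by blast
      finally show ?thesis .
    qed
    show "2 * card kernels + (\<Sum>p\<in>kernels. card (leaves p)) + w = card (verts H)"
      unfolding w_def by (rule card_vertices)
  qed
  then show ?thesis by blast
qed

section \<open>Numerical consequences of the decomposition\<close>

lemma real_choose_two: "real (n choose 2) = real n * (real n - 1) / 2"
proof (induction n)
  case (Suc n)
  have "Suc n choose 2 = n + (n choose 2)" by (simp add: numeral_2_eq_2)
  then show ?case using Suc by (simp add: field_simps)
qed simp

lemma choose_two_le_mult:
  assumes "real r \<le> b"
  shows "real (r choose 2) \<le> (b - 1) / 2 * real r"
proof -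
  have "real r * (real r - 1) \<le> real r * (b - 1)" by (rule mult_left_mono) (use assms in auto)
  then show ?thesis unfolding real_choose_two by (simp add: field_simps)
qed

lemma sum_le_mult_sum:
  fixes r s :: "'b \<Rightarrow> nat"
  assumes "\<And>p. p \<in> P \<Longrightarrow> real (s p) \<le> c * real (r p)"
  shows "real (\<Sum>p\<in>P. s p) \<le> c * real (\<Sum>p\<in>P. r p)"
  using sum_mono[of P "\<lambda>p. real (s p)" "\<lambda>p. c * real (r p)"] assms
  by (simp add: sum_distrib_left)

lemma choose_two_diff:
  "real (v choose 2) - real (k choose 2) = (real v - real k) * (real v + real k - 1) / 2"
  unfolding real_choose_two by (simp add: field_simps)

text \<open>With k instead of v kernels, t = v - k, at least t (v - 1) / 2 unions are lost and at
  most 2 t + 1 vertices are left over. At 9 n / 80 edges per vertex these bring back only about 9 t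
  v / 20, so a deficit of about t v / 20 remains.\<close>

lemma nearly_thick:
  fixes r s :: "'b \<Rightarrow> nat"
  assumes n: "n \<ge> 10000" and fin: "finite P"
    and tot: "2 * card P + (\<Sum>p\<in>P. r p) + w = n"
    and s: "\<And>p. p \<in> P \<Longrightarrow> s p \<le> r p choose 2"
    and sn: "\<And>p. p \<in> P \<Longrightarrow> real (s p) \<le> 9 / 80 * real n * real (r p)"
    and j: "4 * j \<le> 49 * w"
    and m: "real ((n div 2) choose 2) - real n / 5 \<le> real (card P choose 2) + real (\<Sum>p\<in>P. s p) + real j"
  shows "(\<Sum>p\<in>P. r p) + w \<le> 1"
proof (rule ccontr)
  assume neg: "\<not> ?thesis"
  define q where "q = (\<Sum>p\<in>P. r p) + w"
  define v where "v = n div 2"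
  define k where "k = card P"
  define t where "t = v - k"
  have q2: "q \<ge> 2" using neg unfolding q_def by simp
  have kq: "2 * k + q = n" using tot unfolding k_def q_def by simp
  have vn: "2 * v \<le> n" "n \<le> 2 * v + 1" unfolding v_def by auto
  have k: "real k = real v - real t" and t1: "t \<ge> 1" and qt: "q \<le> 2 * t + 1" "2 * t \<le> q"
    unfolding t_def using kq q2 vn by linarith+
  have bound: "real (\<Sum>p\<in>P. s p) + real j \<le> c * real q"
    if "\<And>p. p \<in> P \<Longrightarrow> real (s p) \<le> c * real (r p)" "c \<ge> 49 / 4" for c
  proof -
    have "real j \<le> c * real w" 
      using j mult_right_mono[OF that(2), of "real w"] by linarith
    then show ?thesis using sum_le_mult_sum[of P s c r] that(1) unfolding q_def by (simp add: distrib_left)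
  qed
  have main: "real t * (real v + real k - 1) / 2 - real n / 5 \<le> real (\<Sum>p\<in>P. s p) + real j"
    using m choose_two_diff[of v k] k unfolding v_def[symmetric] k_def[symmetric] by simp
  have nv: "real n \<le> 2 * real v + 1" "real v \<ge> 4999" using vn n by linarith+
  have t1': "real t \<ge> 1" using t1 by simp
  have qt': "real q \<le> 2 * real t + 1" using qt by linarith
  \<comment> \<open>For small t a deficit of t v / 20 would not exceed the allowance n / 5. But then
    k is close to v, the loss is almost t v, and leaf sets of at most 100 vertices carry at most 50
    edges per vertex.\<close>
  show False
  proof (cases "q \<le> 100")
    case True
    have "real (s p) \<le> 50 * real (r p)" if p: "p \<in> P" for p
    proof -
      have "r p \<le> q" unfolding q_def using member_le_sum[of p P r] p fin by simp
      then have "real (r p choose 2) \<le> 50 * real (r p)"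
        using choose_two_le_mult[of "r p" 101] True by simp
      then show ?thesis using s[OF p] by (meson of_nat_mono order_trans)
    qed
    from bound[OF this] have b: "real (\<Sum>p\<in>P. s p) + real j \<le> 50 * real q" by simp
    have "t \<le> 50" using True qt by simp
    then have "real v + real k - 1 \<ge> 2 * real v - 51" using k by simp
    then have "real t * (2 * real v - 51) \<le> real t * (real v + real k - 1)" by (intro mult_left_mono) auto
    then have "real t * (2 * real v - 51) / 2 - real n / 5 \<le> 50 * (2 * real t + 1)"
      using main b qt' by argo
    then have "real t * (real v - 51 / 2 - 150) \<le> real n / 5"
      using t1' by (simp add: algebra_simps)
    moreover have "1 * (real v - 51 / 2 - 150) \<le> real t * (real v - 51 / 2 - 150)"
      using t1' nv by (intro mult_right_mono) auto
    ultimately show False using nv by argo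
  next
    case False
    have b: "real (\<Sum>p\<in>P. s p) + real j \<le> 9 / 80 * real n * real q"
      using bound[of "9 / 80 * real n"] sn n by simp
    have "t \<ge> 50" using False qt by linarith
    then have t50: "real t \<ge> 50" by simp
    have "real t * (real v - 1) \<le> real t * (real v + real k - 1)" by (intro mult_left_mono) auto
    moreover have "real n * real q \<le> (2 * real v + 1) * (2 * real t + 1)"
      using nv qt' by (intro mult_mono) auto
    ultimately have "real t * (real v - 1) / 2 - (2 * real v + 1) / 5 \<le> 9 / 80 * ((2 * real v + 1) * (2 * real t + 1))"
      using main b nv by argo
    then have "real t * (real v / 20 - 29 / 40) \<le> (2 * real v + 1) / 5 + 9 / 80 * (2 * real v + 1)"
      by argo
    moreover have "50 * (real v / 20 - 29 / 40) \<le> real t * (real v / 20 - 29 / 40)"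
      using t50 nv by (intro mult_right_mono) auto
    ultimately show False using nv by argo
  qed
qed

text \<open>Up to n/4 + 3/2 leaves the binomial coefficient is small enough, beyond that the bound
  on the number of edges is. At the threshold (r - 1) / 2 equals n/8 + 1/4.\<close>

lemma cap_bound:
  assumes "real s \<le> real (r choose 2)" "real s < (real n)\<^sup>2 / 32 + real n / 8"
  shows "real s \<le> (real n / 8 + 1 / 4) * real r"
proof (cases "real r \<le> real n / 4 + 3 / 2")
  case True
  have "(real n / 4 + 3 / 2 - 1) / 2 = real n / 8 + 1 / 4" by simp
  then show ?thesis using choose_two_le_mult[OF True] assms(1) by argo
next
  case False
  have "(real n / 8 + 1 / 4) * (real n / 4 + 3 / 2) \<le> (real n / 8 + 1 / 4) * real r"
    using False by (intro mult_left_mono) auto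
  moreover have "(real n / 8 + 1 / 4) * (real n / 4 + 3 / 2) = (real n)\<^sup>2 / 32 + real n / 4 + 3 / 8"
    by (simp add: field_simps power2_eq_square)
  ultimately show ?thesis using assms(2) of_nat_0_le_iff[of n, where 'a = real] by argo
qed

text \<open>Below C(n/4 + 1, 2) edges a star has at most n/8 + 1/4 edges per leaf, and even this
  critical rate does not make up for the lost unions of kernels. The linear term n/8 is what
  \<open>cap_ge\<close> needs.\<close>

lemma degree_lower_bound:
  fixes r s :: "'b \<Rightarrow> nat"
  assumes n: "n \<ge> 10000" and fin: "finite P"
    and tot: "2 * card P + (\<Sum>p\<in>P. r p) + w = n"
    and r1: "\<And>p. p \<in> P \<Longrightarrow> r p \<noteq> 1"
    and s: "\<And>p. p \<in> P \<Longrightarrow> s p \<le> r p choose 2"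
    and sd: "\<And>p. p \<in> P \<Longrightarrow> s p \<le> d"
    and j: "4 * j \<le> 49 * w" "w \<le> 1 \<Longrightarrow> j = 0"
    and m: "((n div 2) choose 2) + 1 \<le> (card P choose 2) + (\<Sum>p\<in>P. s p) + j"
  shows "real d \<ge> (real n)\<^sup>2 / 32 + real n / 8"
proof (rule ccontr)
  assume "\<not> ?thesis"
  then have d: "real d < (real n)\<^sup>2 / 32 + real n / 8" by (rule not_le_imp_less)
  define q where "q = (\<Sum>p\<in>P. r p) + w"
  define v where "v = n div 2"
  define k where "k = card P"
  have kq: "2 * k + q = n" using tot unfolding k_def q_def by simp
  have vn: "2 * v \<le> n" "n \<le> 2 * v + 1" unfolding v_def by auto
  have "real (s p) \<le> (real n / 8 + 1 / 4) * real (r p)" if "p \<in> P" for p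
    using cap_bound[of "s p" "r p" n] s[OF that] sd[OF that] d by simp
  then have sb: "real (\<Sum>p\<in>P. s p) \<le> (real n / 8 + 1 / 4) * real (\<Sum>p\<in>P. r p)" by (rule sum_le_mult_sum)
  have jb: "real j \<le> 49 / 4 * real w" using j by linarith
  have m': "real (v choose 2) + 1 \<le> real (k choose 2) + real (\<Sum>p\<in>P. s p) + real j"
    using m unfolding v_def k_def by linarith
  \<comment> \<open>No room for stars; at most three stars, with about 3 n^2/32 < n^2/8 edges
    together; and the genuine trade-off.\<close>
  consider "q \<le> 1" | "k \<le> 3" | "q \<ge> 2" "k \<ge> 4" by linarith
  then show False
  proof cases
    case 1
    have "r p = 0" if "p \<in> P" for p
      using r1[OF that] member_le_sum[of p P r] that fin 1 unfolding q_def by simp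
    then have "(\<Sum>p\<in>P. s p) = 0" using s by (simp add: binomial_eq_0)
    moreover have "j = 0" using j(2) 1 unfolding q_def by simp
    moreover have "k = v" using kq 1 unfolding v_def by linarith
    ultimately show False using m' by simp
  next
    case 2
    have "real (\<Sum>p\<in>P. s p) \<le> (\<Sum>p\<in>P. real d)" unfolding of_nat_sum using sd by (intro sum_mono) simp
    also have "\<dots> \<le> 3 * real d" using 2 unfolding k_def by (simp add: mult_right_mono)
    finally have "real (\<Sum>p\<in>P. s p) \<le> 3 * real d" .
    then have "real (\<Sum>p\<in>P. s p) \<le> 3 * ((real n)\<^sup>2 / 32 + real n / 8)" using d by argo
    moreover have "real w \<le> real n" using kq unfolding q_def by linarith
    moreover have "k choose 2 \<le> 3 choose 2" using 2 by (rule binomial_right_mono) 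
    then have "real (k choose 2) \<le> 3" by (simp add: numeral_eq_Suc)
    moreover have "real (v choose 2) \<ge> ((real n - 1) / 2) * ((real n - 1) / 2 - 1) / 2"
    proof -
      have "real n \<le> 2 * real v + 1" using vn by linarith
      then have "(real n - 1) / 2 \<le> real v" by simp
      then have "((real n - 1) / 2) * ((real n - 1) / 2 - 1) \<le> real v * (real v - 1)"
        using n by (intro mult_mono) auto
      then show ?thesis unfolding real_choose_two by simp
    qed
    ultimately have "((real n - 1) / 2) * ((real n - 1) / 2 - 1) / 2 \<le> 3 + 3 * ((real n)\<^sup>2 / 32 + real n / 8) + 49 / 4 * real n"
      using m' jb by argo
    then have "real n * (real n / 32 - 14) \<le> 3" by (simp add: field_simps power2_eq_square)
    moreover have "10000 * (real n / 32 - 14) \<le> real n * (real n / 32 - 14)"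
      using n by (intro mult_right_mono) auto
    moreover have "real n \<ge> 10000" using n by simp
    ultimately show False by argo
  next
    case 3
    define t where "t = v - k"
    \<comment> \<open>The parity of n matters: for odd n the stars get one more vertex, worth about
      v/4 edges, which is comparable with the margin.\<close>
    define e where "e = n - 2 * v"
    have nats: "v = k + t" "1 \<le> t" "q = 2 * t + e" "e \<le> 1" "n = 2 * v + e"
      unfolding t_def e_def using kq 3 vn by linarith+
    have k: "real k = real v - real t" and t1: "real t \<ge> 1" and qt: "real q = 2 * real t + real e"
      and ne: "real n = 2 * real v + real e" and k4: "real k \<ge> 4"
      using nats 3 by simp_all
    have vk: "real v - real k = real t" using k by simp
    have "real w \<ge> 0" by simp
    then have "49 / 4 * real w \<le> (real n / 8 + 1 / 4) * real w" using n by (intro mult_right_mono) auto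
    then have "real (\<Sum>p\<in>P. s p) + real j \<le> (real n / 8 + 1 / 4) * real q"
      using sb jb unfolding q_def by (simp add: distrib_left)
    then have "real t * (real v + real k - 1) / 2 + 1 \<le> (real n / 8 + 1 / 4) * real q"
      using m' choose_two_diff[of v k, unfolded vk] by argo
    then have A: "real t * (real k / 2 - 1) - real t * real e / 4 + 1 \<le> real e * (real v / 4 + real e / 8 + 1 / 4)"
      unfolding qt ne k by (simp add: field_simps)
    \<comment> \<open>For fixed v the margin is concave in t, so the extreme cases are t = 1 and k =
      4; this product covers everything in between.\<close>
    have "(real t - 1) * (real k - 4) \<ge> 0" using t1 k4 by simp
    then have B: "real t * real k \<ge> 4 * real t + real k - 4" by (simp add: field_simps)
    have "e = 0 \<or> e = 1" using nats(4) by linarith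
    then show False
    proof
      assume "e = 0"
      then have "real t * (real k / 2 - 1) + 1 \<le> 0" using A by simp
      moreover have "real t * (real k / 2 - 1) \<ge> 0" using t1 k4 by simp
      ultimately show False by linarith
    next
      assume "e = 1"
      then have "real t * real k / 2 - 5 / 4 * real t + 1 \<le> real v / 4 + 3 / 8" using A by (simp add: field_simps)
      moreover have "real v \<ge> 4999" using ne n nats(4) by linarith
      ultimately show False using B k t1 k4 by argo
    qed
  qed
qed

section \<open>Exchange arguments for star configurations\<close>

lemma choose_two_add: "real ((a + b) choose 2) = real (a choose 2) + real a * real b + real b * (real b - 1) / 2"
  unfolding real_choose_two by (simp add: field_simps)

lemma choose_two_move:
  assumes "b \<ge> t"
  shows "real ((a + t) choose 2) + real ((b - t) choose 2)
    = real (a choose 2) + real (b choose 2) + real t * (real a - real b + real t)"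
  using assms unfolding real_choose_two by (simp add: of_nat_diff field_simps)

lemma sum_add_two: "(\<Sum>p\<in>X. f p + 2) = (\<Sum>p\<in>X. f p) + 2 * card X" for f :: "'b \<Rightarrow> nat"
  unfolding sum.distrib by simp

text \<open>Here \<open>r p\<close> and \<open>s p\<close> are the numbers of leaves and edges of the 2-star centred at the kernel \<open>p\<close>,
  \<open>kk\<close> counts the unions of two kernels among the edges, and \<open>j\<close> the edges of neither kind, which
  live on \<open>w\<close> vertices.\<close>

locale star_config =
  fixes P :: "'b set" and r s :: "'b \<Rightarrow> nat" and n w kk j d m :: nat
  assumes n_large: "n \<ge> 1000000" and fin: "finite P"
    and total: "2 * card P + (\<Sum>p\<in>P. r p) + w = n"
    and kk: "kk \<le> card P choose 2"
    and s_choose: "p \<in> P \<Longrightarrow> s p \<le> r p choose 2"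
    and s_d: "p \<in> P \<Longrightarrow> s p \<le> d"
    and j: "4 * j \<le> 49 * w" and j0: "w \<le> 1 \<Longrightarrow> j = 0"
    and m_le: "m \<le> kk + j + (\<Sum>p\<in>P. s p)"
    and m_ge: "((n div 2) choose 2) + 1 \<le> m"
    and d_ge: "real d \<ge> (real n)\<^sup>2 / 32 + real n / 8"
    and optimal: "(\<Sum>l\<leftarrow>ls. l + 2) \<le> n \<Longrightarrow> (\<Sum>l\<leftarrow>ls. min (l choose 2) (d - 1)) < m"
begin

abbreviation g :: "nat \<Rightarrow> nat" where "g l \<equiv> min (l choose 2) (d - 1)"

text \<open>The largest number of leaves of a complete 2-star with fewer than \<open>d\<close> edges.\<close>

definition "cap = (LEAST l. d \<le> l choose 2) - 1"

lemma d_pos: "d > 0"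
proof -
  have "(real n)\<^sup>2 / 32 + real n / 8 > 0" using n_large by (intro add_pos_pos) auto
  then have "real d > 0" using d_ge by linarith
  then show ?thesis by simp
qed

lemma cap: "cap choose 2 \<le> d - 1" "d \<le> Suc cap choose 2"
proof -
  have "Suc d choose 2 = d + (d choose 2)" by (simp add: numeral_2_eq_2)
  then have "d \<le> Suc d choose 2" by simp
  then have L: "d \<le> (LEAST l. d \<le> l choose 2) choose 2" by (rule LeastI)
  then have pos: "(LEAST l. d \<le> l choose 2) \<noteq> 0" using d_pos by (metis binomial_eq_0_iff not_le zero_less_numeral)
  then have "cap < (LEAST l. d \<le> l choose 2)" unfolding cap_def by simp
  then have "\<not> d \<le> cap choose 2" by (rule not_less_Least)
  then show "cap choose 2 \<le> d - 1" by simp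
  show "d \<le> Suc cap choose 2" using L pos unfolding cap_def by simp
qed

lemma g_small: "l \<le> cap \<Longrightarrow> g l = l choose 2"
  using cap(1) binomial_right_mono[of l cap 2] by simp

text \<open>With \<open>cap\<close> below n/4, C(cap + 1, 2) would be below C(n/4 + 1, 2), hence
  below \<open>d\<close>. As a consequence, four blocks of \<open>cap + 2\<close> vertices do not
  fit into n.\<close>

lemma cap_ge: "n \<le> 4 * cap"
proof (rule ccontr)
  assume "\<not> ?thesis"
  then have "real cap + 1 / 4 \<le> real n / 4" by linarith
  then have "(real cap + 1) * real cap < (real n / 4 + 1) * (real n / 4)"
    by (intro mult_strict_mono) auto
  then have "real (Suc cap choose 2) < (real n)\<^sup>2 / 32 + real n / 8"
    unfolding real_choose_two by (simp add: field_simps power2_eq_square)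
  then show False using cap(2) d_ge by linarith
qed

text \<open>Only a star with more than \<open>cap\<close> leaves can have \<open>d\<close> edges,
  and cutting it down to \<open>d - 1\<close> costs a single edge.\<close>

lemma s_g: "p \<in> P \<Longrightarrow> s p \<le> g (r p) + (if cap < r p then 1 else 0)"
  using s_choose[of p] s_d[of p] g_small[of "r p"] d_pos by auto

lemma sum_block_le:
  assumes "X \<subseteq> P" shows "(\<Sum>p\<in>X. r p + 2) \<le> n"
proof -
  have "(\<Sum>p\<in>X. r p + 2) \<le> (\<Sum>p\<in>P. r p + 2)" using assms fin by (intro sum_mono2) auto
  also have "\<dots> \<le> n" using total unfolding sum_add_two by simp
  finally show ?thesis .
qed

lemma card_full: "card {p \<in> P. cap < r p} \<le> 3"
proof (rule ccontr)
  assume "\<not> ?thesis"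
  then have "4 * (cap + 3) \<le> card {p \<in> P. cap < r p} * (cap + 3)" by (intro mult_right_mono) auto
  also have "\<dots> = (\<Sum>p\<in>{p \<in> P. cap < r p}. cap + 3)" by simp
  also have "\<dots> \<le> (\<Sum>p\<in>{p \<in> P. cap < r p}. r p + 2)" by (rule sum_mono) auto
  also have "\<dots> \<le> n" by (rule sum_block_le) auto
  finally show False using cap_ge by simp
qed

lemma sum_s_le:
  assumes "X \<subseteq> P" shows "(\<Sum>p\<in>X. s p) \<le> (\<Sum>p\<in>X. g (r p)) + 3"
proof -
  have finX: "finite X" using assms fin finite_subset by blast
  have "(\<Sum>p\<in>X. s p) \<le> (\<Sum>p\<in>X. g (r p) + (if cap < r p then 1 else 0))"
    by (rule sum_mono) (use s_g assms in blast)
  also have "\<dots> = (\<Sum>p\<in>X. g (r p)) + card {p \<in> X. cap < r p}"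
    using finX by (simp add: sum.distrib sum.If_cases Int_def)
  also have "card {p \<in> X. cap < r p} \<le> card {p \<in> P. cap < r p}"
    using assms fin by (intro card_mono) auto
  finally show ?thesis using card_full by linarith
qed

lemma optimal_set:
  assumes "finite X" "(\<Sum>p\<in>X. f p + 2) + (\<Sum>l\<leftarrow>ex. l + 2) \<le> n"
  shows "(\<Sum>p\<in>X. g (f p)) + (\<Sum>l\<leftarrow>ex. g l) < m"
proof -
  obtain xs where xs: "set xs = X" "distinct xs" using finite_distinct_list[OF assms(1)] by blast
  have sums: "(\<Sum>l\<leftarrow>map f xs. h l) = (\<Sum>p\<in>X. h (f p))" for h :: "nat \<Rightarrow> nat"
    using xs by (simp add: sum_list_distinct_conv_sum_set comp_def)
  show ?thesis using optimal[of "map f xs @ ex"] sums[of "\<lambda>l. l + 2"] sums[of g] assms(2) by simp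
qed

section \<open>Big stars and the vertices they leave over\<close>

definition "big = {p \<in> P. n \<le> 50 * r p}"
definition "small = P - big"
definition "left = n - (\<Sum>p\<in>big. r p + 2)"
text \<open>The edges given up when only the big stars are kept. By optimality, any better use of
  the \<open>left\<close> vertices can gain at most \<open>waste + 2\<close>.\<close>

definition "waste = kk + j + (\<Sum>p\<in>small. s p)"

lemma big_subset: "big \<subseteq> P" and small_subset: "small \<subseteq> P"
  unfolding big_def small_def by auto

lemma finite_big: "finite big" and finite_small: "finite small"
  using fin big_subset small_subset finite_subset by blast+

lemma sum_P: "(\<Sum>p\<in>P. f p) = (\<Sum>p\<in>big. f p) + (\<Sum>p\<in>small. f p)" for f :: "'b \<Rightarrow> nat"
  unfolding small_def using sum.subset_diff[OF big_subset fin] by (simp add: add.commute)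

lemma card_P: "card P = card big + card small"
  using sum_P[of "\<lambda>_. 1"] by simp

lemma left_eq: "left = 2 * card small + (\<Sum>p\<in>small. r p) + w"
proof -
  have "(\<Sum>p\<in>big. r p + 2) + (2 * card small + (\<Sum>p\<in>small. r p) + w) = n"
    using total sum_P[of r] card_P unfolding sum_add_two by simp
  then show ?thesis unfolding left_def by linarith
qed

lemma left_add: "(\<Sum>p\<in>big. r p + 2) + left = n"
  unfolding left_def using sum_block_le[OF big_subset] by simp

lemma m_waste: "m \<le> (\<Sum>p\<in>big. s p) + waste"
  using m_le sum_P[of s] unfolding waste_def by linarith

text \<open>The 2 is 3 - 1: capping the big stars costs at most three edges, and the inequality in
  \<open>optimal_set\<close> is strict.\<close>

lemma improve_left:
  assumes "(\<Sum>l\<leftarrow>ex. l + 2) \<le> left" shows "(\<Sum>l\<leftarrow>ex. g l) \<le> waste + 2"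
  using optimal_set[OF finite_big, of r ex] assms left_add m_waste sum_s_le[OF big_subset] by linarith

lemma sum_update:
  fixes f :: "'b \<Rightarrow> nat" and h :: "nat \<Rightarrow> nat"
  assumes "finite X" "p \<in> X"
  shows "(\<Sum>q\<in>X. h ((f(p := v)) q)) + h (f p) = (\<Sum>q\<in>X. h (f q)) + h v"
proof -
  have "(\<Sum>q\<in>X - {p}. h ((f(p := v)) q)) = (\<Sum>q\<in>X - {p}. h (f q))" by (rule sum.cong) auto
  then show ?thesis
    using sum.remove[OF assms, of "\<lambda>q. h (f q)"] sum.remove[OF assms, of "\<lambda>q. h ((f(p := v)) q)"] by simp
qed

text \<open>The comparison of \<open>improve_left\<close> when t of the remaining vertices first
  join a big star that stays within \<open>cap\<close>.\<close>

lemma improve_big: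
  assumes p: "p \<in> big" and t: "r p + t \<le> cap" and ex: "t + (\<Sum>l\<leftarrow>ex. l + 2) \<le> left"
  shows "((r p + t) choose 2) + (\<Sum>l\<leftarrow>ex. g l) \<le> (r p choose 2) + waste + 2"
proof -
  let ?f = "r(p := r p + t)"
  have "(\<Sum>q\<in>big. ?f q + 2) = (\<Sum>q\<in>big. r q + 2) + t"
    using sum_update[OF finite_big p, of "\<lambda>l. l + 2" r "r p + t"] by simp
  then have "(\<Sum>q\<in>big. g (?f q)) + (\<Sum>l\<leftarrow>ex. g l) < m"
    using ex left_add by (intro optimal_set[OF finite_big]) linarith
  moreover have "(\<Sum>q\<in>big. g (?f q)) + (r p choose 2) = (\<Sum>q\<in>big. g (r q)) + ((r p + t) choose 2)"
    using sum_update[OF finite_big p, of g r "r p + t"] g_small[of "r p"] g_small[of "r p + t"] t by simp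
  ultimately show ?thesis using m_waste sum_s_le[OF big_subset] by linarith
qed

lemma card_big: "card big \<le> 50"
proof (rule ccontr)
  assume "\<not> ?thesis"
  then have "51 * n \<le> card big * n" by (intro mult_right_mono) auto
  also have "\<dots> = (\<Sum>p\<in>big. n)" by simp
  also have "\<dots> \<le> (\<Sum>p\<in>big. 50 * (r p + 2))" by (rule sum_mono) (auto simp: big_def)
  also have "\<dots> = 50 * (\<Sum>p\<in>big. r p + 2)" by (rule sum_distrib_left[symmetric])
  also have "\<dots> \<le> 50 * n" using sum_block_le[OF big_subset] by (rule mult_left_mono) simp
  finally show False using n_large by simp
qed

lemma n_real: "real n \<ge> 1000000" using n_large by simp

lemma j_real: "real j \<le> 49 / 4 * real w" using j by linarith

lemma sum_small: "real (\<Sum>p\<in>small. s p) \<le> real n / 100 * real (\<Sum>p\<in>small. r p)"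
proof (rule sum_le_mult_sum)
  fix p assume p: "p \<in> small"
  then have "50 * r p < n" unfolding small_def big_def by auto
  then have "real (r p) \<le> real n / 50 + 1" by linarith
  from choose_two_le_mult[OF this] have "real (r p choose 2) \<le> real n / 100 * real (r p)" by simp
  then show "real (s p) \<le> real n / 100 * real (r p)" using s_choose[of p] p small_subset by fastforce
qed

lemma left_real: "real left = 2 * real (card small) + real (\<Sum>p\<in>small. r p) + real w"
  unfolding left_eq by simp

lemma sum_small_j: "real (\<Sum>p\<in>small. s p) + real j \<le> real n / 100 * (real left - 2 * real (card small))"
proof -
  have "49 / 4 * real w \<le> real n / 100 * real w" using n_large by (intro mult_right_mono) auto
  then have "real (\<Sum>p\<in>small. s p) + real j \<le> real n / 100 * real (\<Sum>p\<in>small. r p) + real n / 100 * real w"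
    using sum_small j_real by linarith
  also have "\<dots> = real n / 100 * (real left - 2 * real (card small))" unfolding left_real by (simp add: algebra_simps)
  finally show ?thesis .
qed

lemma kk_real: "real kk \<le> (real (card big) + real (card small)) * (real (card big) + real (card small) - 1) / 2"
  using kk real_choose_two[of "card P"] unfolding card_P by (metis of_nat_add of_nat_mono)

lemma waste_bound: "real waste \<le> 1250 + 25 * real left + (real left)\<^sup>2 / 8 + real n * real left / 100"
proof -
  let ?c = "real (card big)" and ?k = "real (card small)" and ?u = "real left"
  have c: "0 \<le> ?c" "?c \<le> 50" using card_big by simp_all
  have "2 * card small \<le> left" using left_eq by simp
  then have k: "0 \<le> ?k" "2 * ?k \<le> ?u" by simp_all
  have "(?c + ?k) * (?c + ?k - 1) \<le> (?c + ?k) * (?c + ?k)" using c k by (intro mult_left_mono) auto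
  also have "\<dots> \<le> (50 + ?u / 2) * (50 + ?u / 2)" using c k by (intro mult_mono) auto
  also have "\<dots> = 2500 + 50 * ?u + ?u\<^sup>2 / 4" by (simp add: field_simps power2_eq_square)
  finally have "(?c + ?k) * (?c + ?k - 1) / 2 \<le> 1250 + 25 * ?u + ?u\<^sup>2 / 8" by simp
  then have "real kk \<le> 1250 + 25 * ?u + ?u\<^sup>2 / 8" using kk_real by (rule order_trans[rotated])
  moreover have "real n / 100 * (?u - 2 * ?k) \<le> real n / 100 * ?u"
    using k by (intro mult_left_mono) auto
  ultimately show ?thesis using sum_small_j unfolding waste_def of_nat_add by argo
qed

text \<open>Otherwise the leftover vertices could carry one, two or three complete stars with more
  edges than \<open>waste_bound\<close> permits. If more than 4/5 of all vertices are left over, all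
  stars are sparse enough for \<open>nearly_thick\<close>.\<close>

lemma left_small: "25 * left < n"
proof (rule ccontr)
  assume neg: "\<not> ?thesis"
  let ?u = "real left"
  have u_n: "left \<le> n" unfolding left_def by simp
  have bound: "x \<le> 1252 + 25 * ?u + ?u\<^sup>2 / 8 + real n * ?u / 100" if "x \<le> real waste + 2" for x
    using that waste_bound by linarith
  have u: "?u \<ge> real n / 25" "?u \<ge> 40000" using neg n_large by linarith+
  \<comment> \<open>The gap between 105/10000 and 1/100 absorbs the lower-order terms, as u and n
    are large.\<close>
  have contra: False if "?u * (c * ?u - real n / 100 - 40) \<le> 1252" "c * ?u \<ge> 105 / 10000 * real n" for c
  proof -
    have "40000 * (c * ?u - real n / 100 - 40) \<le> ?u * (c * ?u - real n / 100 - 40)"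
      using u(2) that(2) n_real by (intro mult_right_mono) auto
    then show False using that n_real by argo
  qed
  \<comment> \<open>The stars must stay within \<open>cap\<close>: one star on u vertices does up to
    u = n/4, two on 5u/12 and three on 5u/16 vertices do up to 6n/10 and 8n/10, because 5/12 * 6/10
    = 5/16 * 8/10 = 1/4. Their quadratic coefficients 1/2, 25/144 and 75/512 all exceed the 1/8 in
    \<open>waste_bound\<close>.\<close>
  consider (a) "4 * left \<le> n" | (b) "n < 4 * left" "10 * left \<le> 6 * n"
    | (c) "6 * n < 10 * left" "10 * left \<le> 8 * n" | (d) "8 * n < 10 * left" by linarith
  then show False
  proof cases
    case a
    have "left - 2 \<le> cap" using a cap_ge by linarith
    then have "(left - 2) choose 2 \<le> waste + 2"
      using improve_left[of "[left - 2]"] g_small[of "left - 2"] u(2) by simp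
    then have "real ((left - 2) choose 2) \<le> real waste + 2" by linarith
    moreover have "real (left - 2) = ?u - 2" using u(2) by (simp add: of_nat_diff)
    ultimately have "(?u - 2) * (?u - 3) / 2 \<le> real waste + 2" unfolding real_choose_two by simp
    from bound[OF this] have "?u * (3 / 8 * ?u - real n / 100 - 40) \<le> 1252 - 25 / 2 * ?u"
      by (simp add: field_simps power2_eq_square)
    then have "?u * (3 / 8 * ?u - real n / 100 - 40) \<le> 1252" using u(2) by linarith
    then show False by (rule contra) (use u n_real in linarith)
  next
    case b
    define l where "l = 5 * left div 12 - 2"
    have "l \<le> cap" using b cap_ge unfolding l_def by linarith
    moreover have "l + 2 = 5 * left div 12" using u(2) unfolding l_def by linarith
    then have "2 * (l + 2) \<le> left" by simp
    ultimately have "2 * (l choose 2) \<le> waste + 2"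
      using improve_left[of "[l, l]"] g_small[of l] by simp
    then have "2 * real (l choose 2) \<le> real waste + 2" by linarith
    moreover have "5 / 12 * ?u - 3 \<le> real l" unfolding l_def using u(2) by linarith
    then have "(5 / 12 * ?u - 3) * (5 / 12 * ?u - 4) \<le> real l * (real l - 1)"
      using u(2) by (intro mult_mono) auto
    ultimately have "(5 / 12 * ?u - 3) * (5 / 12 * ?u - 4) \<le> real waste + 2" unfolding real_choose_two by simp
    from bound[OF this] have "?u * (7 / 144 * ?u - real n / 100 - 40) \<le> 1252"
      using u(2) by (simp add: field_simps power2_eq_square)
    then show False by (rule contra) (use b(1) in linarith)
  next
    case c
    define l where "l = 5 * left div 16 - 2"
    have "l \<le> cap" using c cap_ge unfolding l_def by linarith
    moreover have "l + 2 = 5 * left div 16" using u(2) unfolding l_def by linarith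
    then have "3 * (l + 2) \<le> left" by simp
    ultimately have "3 * (l choose 2) \<le> waste + 2"
      using improve_left[of "[l, l, l]"] g_small[of l] by simp
    then have "3 * real (l choose 2) \<le> real waste + 2" by linarith
    moreover have "5 / 16 * ?u - 3 \<le> real l" unfolding l_def using u(2) by linarith
    then have "(5 / 16 * ?u - 3) * (5 / 16 * ?u - 4) \<le> real l * (real l - 1)"
      using u(2) by (intro mult_mono) auto
    ultimately have "3 * ((5 / 16 * ?u - 3) * (5 / 16 * ?u - 4) / 2) \<le> real waste + 2" unfolding real_choose_two by simp
    from bound[OF this] have "?u * (11 / 512 * ?u - real n / 100 - 40) \<le> 1252"
      using u(2) by (simp add: field_simps power2_eq_square)
    then show False by (rule contra) (use c(1) in linarith)
  next
    case d
    \<comment> \<open>Each star has at most n/5 leaves, hence at most about n/10 edges per leaf,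
      less than 9 n / 80.\<close>
    have rp: "real (s p) \<le> 9 / 80 * real n * real (r p)" if p: "p \<in> P" for p
    proof -
      have "5 * r p \<le> n"
      proof (cases "p \<in> big")
        case True
        then have "r p + 2 \<le> (\<Sum>p\<in>big. r p + 2)" using member_le_sum[of p big "\<lambda>p. r p + 2"] finite_big by simp
        then show ?thesis using left_add d by linarith
      qed (use p big_def in auto)
      then have "real (r p) \<le> real n / 5 + 1" by linarith
      from choose_two_le_mult[OF this] have "real (r p choose 2) \<le> real n / 10 * real (r p)" by simp
      also have "\<dots> \<le> 9 / 80 * real n * real (r p)" by (intro mult_right_mono) auto
      finally show ?thesis using s_choose[OF p] by linarith
    qed
    have M: "real ((n div 2) choose 2) + 1 \<le> real (card P choose 2) + real (\<Sum>p\<in>P. s p) + real j"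
      using m_le m_ge kk by linarith
    then have "(\<Sum>p\<in>P. r p) + w \<le> 1"
      using n_large by (intro nearly_thick[OF _ fin total s_choose rp j]) auto
    note one = this
    have "r p \<le> 1" if "p \<in> P" for p using member_le_sum[of p P r] that fin one by simp
    then have "r p choose 2 \<le> 1 choose 2" if "p \<in> P" for p
      using that by (intro binomial_right_mono)
    moreover have "(1::nat) choose 2 = 0" by (simp add: binomial_eq_0)
    ultimately have "s p = 0" if "p \<in> P" for p using s_choose[OF that] that by (metis le_zero_eq le_trans)
    moreover have "j = 0" using j0 one by simp
    moreover have "card P \<le> n div 2" using total by linarith
    then have "card P choose 2 \<le> (n div 2) choose 2" by (rule binomial_right_mono)
    ultimately show False using M by simp
  qed
qed

text \<open>Among five big stars the smallest can pass leaves to another one that is well below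
  \<open>cap\<close>. The gain is at least n^2/4000, more than all the unions of kernels and junk
  edges that the competing stars give up.\<close>

lemma card_big_le_4: "card big \<le> 4"
proof (rule ccontr)
  assume "\<not> ?thesis"
  then have c5: "card big \<ge> 5" by simp
  then have ne: "big \<noteq> {}" by auto
  have "Min (r ` big) \<in> r ` big" using finite_big ne by (intro Min_in) auto
  then obtain b where b: "b \<in> big" "r b = Min (r ` big)" by auto
  have bmin: "r b \<le> r p" if "p \<in> big" for p using b(2) finite_big that by simp
  have "4 \<le> card (big - {b})" using c5 b(1) finite_big by (simp add: card_Diff_singleton)
  then obtain T where T: "T \<subseteq> big - {b}" "card T = 4" "finite T" by (rule obtain_subset_with_card_n)
  have bT: "b \<notin> T" using T by blast
  have sub: "insert b T \<subseteq> P" using T(1) b(1) big_subset by blast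
  have sumT: "r b + 2 + (\<Sum>p\<in>T. r p + 2) \<le> n" using sum_block_le[OF sub] T(3) bT by simp
  have "(\<Sum>p\<in>T. r b + 2) \<le> (\<Sum>p\<in>T. r p + 2)"
    by (rule sum_mono) (use bmin T(1) in auto)
  then have b5: "5 * (r b + 2) \<le> n" using sumT T(2) by simp
  \<comment> \<open>Averaging: the five blocks fit into n \<le> 4 * \<open>cap\<close>, so one of
    the four in \<open>T\<close> falls short of \<open>cap + 2\<close> by at least a quarter of the
    smallest block.\<close>
  have "\<exists>p\<in>T. 4 * (r p + 2) + (r b + 2) \<le> 4 * (cap + 2)"
  proof (rule ccontr)
    assume "\<not> ?thesis"
    then have "(\<Sum>p\<in>T. 4 * (cap + 2)) \<le> (\<Sum>p\<in>T. 4 * (r p + 2) + (r b + 2))"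
      by (intro sum_mono) (meson not_le less_imp_le)
    also have "\<dots> = (\<Sum>p\<in>T. 4 * (r p + 2)) + (\<Sum>p\<in>T. r b + 2)" by (rule sum.distrib)
    also have "(\<Sum>p\<in>T. 4 * (r p + 2)) = 4 * (\<Sum>p\<in>T. r p + 2)" by (rule sum_distrib_left[symmetric])
    also have "(\<Sum>p\<in>T. r b + 2) = 4 * (r b + 2)" by (simp add: T(2))
    finally have "16 * (cap + 2) \<le> 4 * (\<Sum>p\<in>T. r p + 2) + 4 * (r b + 2)" using T(2) by simp
    moreover have "4 * (r b + 2 + (\<Sum>p\<in>T. r p + 2)) \<le> 4 * n" using sumT by (rule mult_le_mono2)
    ultimately have "4 * (cap + 2) \<le> n" by (simp add: distrib_left)
    then show False using cap_ge by simp
  qed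
  then obtain p where p: "p \<in> T" "4 * (r p + 2) + (r b + 2) \<le> 4 * (cap + 2)" by blast
  have pb: "p \<noteq> b" "p \<in> big" "p \<in> P" "b \<in> P" using p T b big_subset by auto
  \<comment> \<open>Either the receiving star is filled up to \<open>cap\<close> or the smallest
    star is emptied.\<close>
  define t where "t = min (cap - r p) (r b)"
  have t: "r p + t \<le> cap" "t \<le> r b" unfolding t_def using p(2) by auto
  let ?f = "(r(p := r p + t))(b := r b - t)"
  have f_sum: "(\<Sum>q\<in>P. h (?f q)) + h (r b) + h (r p) = (\<Sum>q\<in>P. h (r q)) + h (r p + t) + h (r b - t)" for h :: "nat \<Rightarrow> nat"
    using sum_update[OF fin pb(4), of h "r(p := r p + t)" "r b - t"] sum_update[OF fin pb(3), of h r "r p + t"] pb(1) by simp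
  have "(\<Sum>q\<in>P. ?f q + 2) = (\<Sum>q\<in>P. r q + 2)"
    using f_sum[of "\<lambda>l. l + 2"] t(2) by linarith
  then have "(\<Sum>q\<in>P. g (?f q)) < m"
    using optimal_set[OF fin, of ?f "[]"] sum_block_le[of P] by simp
  also have "m \<le> kk + j + (\<Sum>q\<in>P. g (r q)) + 3" using m_le sum_s_le[of P] by simp
  finally have "(\<Sum>q\<in>P. g (?f q)) < kk + j + (\<Sum>q\<in>P. g (r q)) + 3" .
  moreover have "g (r p) = r p choose 2" "g (r b) = r b choose 2"
    "g (r p + t) = (r p + t) choose 2" "g (r b - t) = (r b - t) choose 2"
    using t bmin[OF pb(2)] by (simp_all only: g_small)
  ultimately have "((r p + t) choose 2) + ((r b - t) choose 2) < kk + j + 3 + (r p choose 2) + (r b choose 2)"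
    using f_sum[of g] by linarith
  then have "real t * (real (r p) - real (r b) + real t) \<le> real kk + real j + 3"
    using choose_two_move[OF t(2), of "r p"] by linarith
  \<comment> \<open>The small kernels occupy two leftover vertices each, so there are at most 50 +
    n/50 kernels and about n^2/5000 unions of them.\<close>
  moreover have "real kk + real j \<le> (real n)\<^sup>2 / 5000 + 2 * real n"
  proof -
    have cs: "2 * card small \<le> left" and w: "w \<le> left" using left_eq by simp_all
    have x: "real (card big) + real (card small) \<le> 50 + real n / 50" using cs left_small card_big by linarith
    then have "(real (card big) + real (card small)) * (real (card big) + real (card small) - 1)
        \<le> (50 + real n / 50) * (50 + real n / 50)"
      using c5 by (intro mult_mono) auto
    then have "(real (card big) + real (card small)) * (real (card big) + real (card small) - 1) / 2
        \<le> (50 + real n / 50) * (50 + real n / 50) / 2" by (rule divide_right_mono) simp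
    then have "real kk \<le> (50 + real n / 50) * (50 + real n / 50) / 2" using kk_real by (rule order_trans[rotated])
    also have "\<dots> = 1250 + real n + (real n)\<^sup>2 / 5000" by (simp add: field_simps power2_eq_square)
    finally have "real kk \<le> 1250 + real n + (real n)\<^sup>2 / 5000" .
    moreover have "real j \<le> 49 / 100 * real n" using j w left_small by linarith
    ultimately show ?thesis using n_real by linarith
  qed
  moreover have "real t * (real (r p) - real (r b) + real t) \<ge> (real n)\<^sup>2 / 4000"
  proof (cases "cap - r p \<le> r b")
    case True
    then have tt: "t = cap - r p" unfolding t_def by simp
    have "50 * r b \<ge> n" using b(1) unfolding big_def by simp
    moreover have "4 * r p + r b + 2 \<le> 4 * cap" using p(2) by simp
    ultimately have "200 * t \<ge> n" using tt by linarith
    then have t1: "real t \<ge> real n / 200" by linarith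
    have "real (r p) - real (r b) + real t = real cap - real (r b)" using tt t(1) by (simp add: of_nat_diff)
    moreover have "5 * r b \<le> n" using b5 by simp
    then have "real (r b) \<le> real n / 5" by linarith
    moreover have "real cap \<ge> real n / 4" using cap_ge by linarith
    ultimately have "real (r p) - real (r b) + real t \<ge> real n / 20" by linarith
    then have "real n / 200 * (real n / 20) \<le> real t * (real (r p) - real (r b) + real t)"
      using t1 by (intro mult_mono) auto
    then show ?thesis by (simp add: power2_eq_square)
  next
    case False
    then have tt: "t = r b" unfolding t_def by simp
    have rb: "real (r b) \<ge> real n / 50" "real (r p) \<ge> real n / 50"
      using b(1) pb(2) unfolding big_def by auto
    then have "real n / 50 * (real n / 50) \<le> real (r b) * real (r p)" by (intro mult_mono) auto
    then have "(real n)\<^sup>2 / 2500 \<le> real (r b) * real (r p)" by (simp add: power2_eq_square)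
    moreover have "(real n)\<^sup>2 \<ge> 0" by simp
    ultimately have "(real n)\<^sup>2 / 4000 \<le> real (r b) * real (r p)" by linarith
    then show ?thesis unfolding tt by (simp add: mult.commute)
  qed
  ultimately have "(real n)\<^sup>2 / 20000 \<le> 2 * real n + 3" by linarith
  moreover have "1000000 * real n \<le> (real n)\<^sup>2" unfolding power2_eq_square using n_real by (intro mult_right_mono) auto
  ultimately show False using n_real by linarith
qed

text \<open>Unions of kernels are charged to the two vertices of each small kernel at n/100 per
  vertex, the same rate as in \<open>sum_small_j\<close>; the 6 accounts for unions of at most four
  big kernels. So \<open>waste_le\<close> charges every leftover vertex once.\<close>

lemma card_small_bound: "real ((card big + card small) choose 2) \<le> 6 + real n / 100 * (2 * real (card small))"
proof -
  let ?k = "real (card small)"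
  have "2 * card small \<le> left" using left_eq by simp
  then have k: "?k \<le> real n / 50" using left_small by linarith
  have "(card big + card small) choose 2 \<le> (4 + card small) choose 2"
    using card_big_le_4 by (intro binomial_right_mono) simp
  then have "real ((card big + card small) choose 2) \<le> real ((4 + card small) choose 2)" by linarith
  also have "\<dots> = 6 + ?k * (7 / 2 + ?k / 2)" unfolding real_choose_two by (simp add: field_simps)
  also have "?k * (7 / 2 + ?k / 2) \<le> ?k * (real n / 50)" using k n_real by (intro mult_left_mono) auto
  finally show ?thesis by (simp add: mult.commute)
qed

lemma waste_le: "real waste \<le> 6 + real n / 100 * real left"
  using card_small_bound sum_small_j kk unfolding waste_def card_P
  by (simp add: right_diff_distrib)

lemma waste_left_0: "left = 0 \<Longrightarrow> waste \<le> 6"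
  using waste_le by simp

text \<open>Otherwise all leftover vertices could join \<open>p\<close>. Each would gain at least
  n/50 edges, while the waste given up is only about n/100 per vertex.\<close>

lemma big_near_cap:
  assumes "left > 0" "p \<in> big" shows "cap < r p + left"
proof (rule ccontr)
  assume "\<not> ?thesis"
  then have "(r p + left) choose 2 \<le> (r p choose 2) + waste + 2"
    using improve_big[OF assms(2), of left "[]"] by simp
  then have "real ((r p + left) choose 2) \<le> real (r p choose 2) + real waste + 2" by linarith
  then have "real (r p) * real left + real left * (real left - 1) / 2 \<le> real n / 100 * real left + 8"
    using choose_two_add[of "r p" left] waste_le by linarith
  moreover have "real left * (real left - 1) \<ge> 0" using assms(1) by simp
  moreover have "real n / 50 * real left \<le> real (r p) * real left"
    using assms(2) unfolding big_def by (intro mult_right_mono) auto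
  ultimately have "real n / 100 * real left \<le> 8" by argo
  moreover have "real n / 100 * 1 \<le> real n / 100 * real left" using assms(1) by (intro mult_left_mono) auto
  ultimately show False using n_real by linarith
qed

text \<open>Without small stars the waste is linear in \<open>left\<close>, whereas one star on the
  leftover vertices would have quadratically many edges. The value 459 is 6 + 49/4 * 37 rounded
  down.\<close>

lemma no_small:
  assumes "small = {}" "left > 0"
  shows "left \<le> 37" and "waste \<le> 459"
proof -
  have w: "left = w" using left_eq assms(1) by simp
  have "card P choose 2 \<le> 4 choose 2" using card_P assms(1) card_big_le_4 by (intro binomial_right_mono) simp
  then have "kk \<le> 6" using kk by (simp add: numeral_eq_Suc)
  then have waste: "real waste \<le> 6 + 49 / 4 * real left"
    using j_real assms(1) unfolding waste_def w by simp
  show l37: "left \<le> 37"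
  proof (rule ccontr)
    assume c: "\<not> ?thesis"
    have "left - 2 \<le> cap" using left_small cap_ge by linarith
    then have "(left - 2) choose 2 \<le> waste + 2"
      using improve_left[of "[left - 2]"] g_small[of "left - 2"] c by simp
    then have "real ((left - 2) choose 2) \<le> real waste + 2" by linarith
    moreover have "real (left - 2) = real left - 2" using c by (simp add: of_nat_diff)
    ultimately have "(real left - 2) * (real left - 3) / 2 \<le> 8 + 49 / 4 * real left"
      using waste unfolding real_choose_two by simp
    then have "real left * (real left - 59 / 2) \<le> 10" by (simp add: field_simps)
    moreover have "38 * (38 - 59 / 2) \<le> real left * (real left - 59 / 2)" using c by (intro mult_mono) auto
    ultimately show False by simp
  qed
  show "waste \<le> 459" using waste l37 by linarith
qed

text \<open>The star \<open>a\<close> is later chosen largest among the small ones, and \<open>z\<close> counts the remaining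
  vertices that it misses.\<close>

lemma small_waste:
  assumes a: "a \<in> small"
    and z: "left = r a + 2 + z"
    and x: "x \<ge> 49 / 4" "x \<ge> 9 / 4 + real z / 8"
    and others: "\<And>p. p \<in> small - {a} \<Longrightarrow> (real (r p) - 1) / 2 \<le> x"
  shows "real waste \<le> real (s a) + real (Suc (card big) choose 2) + x * real z"
proof -
  let ?S = "small - {a}" and ?c = "Suc (card big)"
  define k where "k = card ?S"
  have cs: "card small = Suc k" unfolding k_def using a finite_small by (metis card.remove)
  have sr: "(\<Sum>p\<in>small. f p) = f a + (\<Sum>p\<in>?S. f p)" for f :: "'b \<Rightarrow> nat"
    using sum.remove[OF finite_small a] .
  have zz: "z = 2 * k + (\<Sum>p\<in>?S. r p) + w" using left_eq z sr[of r] cs by simp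
  have "card P = ?c + k" using card_P cs by simp
  then have "real kk \<le> real ((?c + k) choose 2)" using kk by simp
  also have "\<dots> = real (?c choose 2) + real ?c * real k + real k * (real k - 1) / 2" by (rule choose_two_add)
  also have "\<dots> = real (?c choose 2) + real k * (real ?c + (real k - 1) / 2)" by (simp add: field_simps)
  \<comment> \<open>Each remaining small kernel pays for its unions with the big kernels and
    \<open>a\<close>, and for half of those with its peers. Spread over its two vertices this costs
    at most 9/4 + z/8 each, since k \<le> z/2 and \<open>?c\<close> \<le> 5.\<close>
  also have "real k * (real ?c + (real k - 1) / 2) \<le> real k * (2 * x)"
  proof (rule mult_left_mono)
    have "real k \<le> real z / 2" using zz by linarith
    moreover have "real ?c \<le> 5" using card_big_le_4 by simp
    ultimately show "real ?c + (real k - 1) / 2 \<le> 2 * x" using x(2) by argo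
  qed simp
  finally have 1: "real kk \<le> real (?c choose 2) + x * (2 * real k)" by (simp add: mult.commute mult.left_commute)
  have 2: "real (\<Sum>p\<in>?S. s p) \<le> x * real (\<Sum>p\<in>?S. r p)"
  proof (rule sum_le_mult_sum)
    fix p assume p: "p \<in> ?S"
    have "real (s p) \<le> real (r p choose 2)" using s_choose p small_subset by fastforce
    also have "\<dots> = (real (r p) - 1) / 2 * real (r p)" unfolding real_choose_two by simp
    also have "\<dots> \<le> x * real (r p)" using others[OF p] by (intro mult_right_mono) auto
    finally show "real (s p) \<le> x * real (r p)" .
  qed
  have "49 / 4 * real w \<le> x * real w" using x(1) by (intro mult_right_mono) auto
  then have 3: "real j \<le> x * real w" using j_real by linarith
  have "x * real z = x * (2 * real k) + x * real (\<Sum>p\<in>?S. r p) + x * real w" unfolding zz by (simp add: distrib_left)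
  then show ?thesis using 1 2 3 sr[of s] unfolding waste_def by simp
qed

lemma largest_small:
  assumes "small \<noteq> {}"
  obtains a z where "a \<in> small" "left = r a + 2 + z"
    "\<And>p. p \<in> small - {a} \<Longrightarrow> r p \<le> r a \<and> r p \<le> z"
proof -
  have "Max (r ` small) \<in> r ` small" using finite_small assms by (intro Max_in) auto
  then obtain a where a: "a \<in> small" "r a = Max (r ` small)" by auto
  have "(\<Sum>p\<in>small. r p) + 2 * card small \<le> left" using left_eq by simp
  then have le: "(\<Sum>p\<in>small. r p + 2) \<le> left" unfolding sum_add_two .
  have split: "(\<Sum>p\<in>small. r p + 2) = (r a + 2) + (\<Sum>p\<in>small - {a}. r p + 2)"
    using sum.remove[OF finite_small a(1)] .
  show ?thesis
  proof (rule that[OF a(1), of "left - (r a + 2)"])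
    show "left = r a + 2 + (left - (r a + 2))" using le split by simp
    fix p assume p: "p \<in> small - {a}"
    then have "r p + 2 \<le> (\<Sum>p\<in>small - {a}. r p + 2)"
      using member_le_sum[of p "small - {a}" "\<lambda>p. r p + 2"] finite_small by simp
    then have "r p \<le> left - (r a + 2)" using le split by linarith
    moreover have "r p \<le> r a" using p a(2) finite_small by simp
    ultimately show "r p \<le> r a \<and> r p \<le> left - (r a + 2)" by simp
  qed
qed

text \<open>Merging all leftover vertices into \<open>a\<close> would gain z * (r a + (z - 1) / 2)
  edges over C(r a, 2), and optimality caps this by 12 + x * z, where 12 is C(5, 2) + 2. From 38
  leftover vertices on, the rate x is too small for that.\<close>

lemma missed_none:
  assumes a: "a \<in> small" and z: "left = r a + 2 + z"
    and others: "\<And>p. p \<in> small - {a} \<Longrightarrow> r p \<le> r a \<and> r p \<le> z"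
    and large: "left \<ge> 38"
  shows "z = 0"
proof (rule ccontr)
  assume z0: "z \<noteq> 0"
  let ?r = "real (r a)" and ?z = "real z"
  \<comment> \<open>The three entries pay for junk, for unions of kernels and for the other small
    stars, which have at most min (r a) z leaves.\<close>
  define x where "x = max (49 / 4) (max (9 / 4 + ?z / 8) (real (min (r a) z) / 2))"
  have w: "real waste \<le> real (s a) + real (Suc (card big) choose 2) + x * ?z"
  proof (rule small_waste[OF a z])
    show "(real (r p) - 1) / 2 \<le> x" if "p \<in> small - {a}" for p
    proof -
      have "real (r p) \<le> real (min (r a) z)" using others[OF that] by simp
      then have "real (r p) / 2 \<le> real (min (r a) z) / 2" by (rule divide_right_mono) simp
      then have "(real (r p) - 1) / 2 \<le> real (min (r a) z) / 2" by (rule order_trans[rotated]) simp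
      then show ?thesis unfolding x_def by (intro max.coboundedI2)
    qed
  qed (auto simp: x_def)
  have "Suc (card big) choose 2 \<le> 5 choose 2" using card_big_le_4 by (intro binomial_right_mono) simp
  then have "real (Suc (card big) choose 2) \<le> 10" by (simp add: numeral_eq_Suc)
  moreover have "real (s a) \<le> real (r a choose 2)" using s_choose a small_subset by fastforce
  moreover have "left - 2 = r a + z" using z by simp
  then have "(r a + z) choose 2 \<le> waste + 2"
    using improve_left[of "[r a + z]"] g_small[of "r a + z"] left_small cap_ge z by simp
  then have "real ((r a + z) choose 2) \<le> real waste + 2" by linarith
  ultimately have A: "?r * ?z + ?z * (?z - 1) / 2 \<le> 12 + x * ?z"
    using w choose_two_add[of "r a" z] by linarith
  have rz: "?r + ?z \<ge> 36" "?z \<ge> 1" using large z z0 by linarith+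
  have small_z: "?z * y \<le> 12" if "x \<le> ?r + (?z - 1) / 2 - y" for y
  proof -
    have "?z * (x + y) \<le> ?z * (?r + (?z - 1) / 2)" using that by (intro mult_left_mono) auto
    then show ?thesis using A by argo
  qed
  have mn: "real (min (r a) z) \<le> ?r" by simp
  \<comment> \<open>A margin y with z * y > 12 is wanted: 13 serves from z = 1 on, and 5 from z = 3
    on.\<close>
  show False
  proof (cases "z \<le> 2")
    case True
    then have "?r \<ge> 34" "?z \<le> 2" using rz by linarith+
    then have "x \<le> ?r + (?z - 1) / 2 - 13" unfolding x_def diff_divide_distrib using rz(2) mn by (intro max.boundedI) linarith+
    from small_z[OF this] show False using rz by linarith
  next
    case False
    then have "?z \<ge> 3" by linarith
    then have "x \<le> ?r + (?z - 1) / 2 - 5" unfolding x_def diff_divide_distrib using rz mn by (intro max.boundedI) linarith+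
    from small_z[OF this] show False using \<open>?z \<ge> 3\<close> by linarith
  qed
qed

text \<open>Some big star has room below \<open>cap\<close>, and one leftover vertex would gain it
  at least n/50 edges. Only a large small star \<open>a\<close> can account for that much waste, and
  then passing leaves from \<open>a\<close> to the big star gains too much.\<close>

lemma four_big: 
  assumes c: "card big = 4" and u: "left > 0"
  shows False
proof -
  have "\<exists>p\<in>big. r p < cap"
  proof (rule ccontr)
    assume "\<not> ?thesis"
    then have "(\<Sum>p\<in>big. cap + 2) \<le> (\<Sum>p\<in>big. r p + 2)" by (intro sum_mono) auto
    then show False using left_add cap_ge c by simp
  qed
  then obtain p where p: "p \<in> big" "r p < cap" by blast
  have rp: "50 * r p \<ge> n" using p(1) unfolding big_def by simp
  have step: "real (r p) \<le> real waste + 2"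
  proof -
    have "(r p + 1) choose 2 \<le> (r p choose 2) + waste + 2"
      using improve_big[OF p(1), of 1 "[]"] p(2) u by simp
    then show ?thesis using choose_two_add[of "r p" 1] by simp
  qed
  show False
  proof (cases "small = {}")
    case True
    then show False using no_small[OF True u] step rp n_large by linarith
  next
    case False
    then obtain a z where a: "a \<in> small" "left = r a + 2 + z"
      "\<And>p. p \<in> small - {a} \<Longrightarrow> r p \<le> r a \<and> r p \<le> z" using largest_small by metis
    have sa: "real (s a) \<le> real (r a choose 2)" using s_choose a small_subset by fastforce
    have c5: "real (Suc (card big) choose 2) = 10" unfolding c by (simp add: numeral_eq_Suc)
    show False
    proof (cases "left \<le> 37")
      case True
      have "real waste \<le> real (s a) + real (Suc (card big) choose 2) + 20 * real z"
      proof (rule small_waste[OF a(1,2)])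
        show "(real (r q) - 1) / 2 \<le> 20" if "q \<in> small - {a}" for q
        proof -
          have "r q \<le> 35" using a(3)[OF that] True a(2) by linarith
          then show ?thesis by simp
        qed
      qed (use True a(2) in auto)
      moreover have "r a choose 2 \<le> 35 choose 2" using True a(2) by (intro binomial_right_mono) simp
      then have "real (r a choose 2) \<le> 595" by (simp add: numeral_eq_Suc)
      moreover have "real z \<le> 35" using True a(2) by linarith
      ultimately show False using sa c5 step rp n_large by linarith
    next
      case False
      then have z: "z = 0" using missed_none[OF a] by simp
      have w: "real waste \<le> real (r a choose 2) + 10"
      proof -
        have "real waste \<le> real (s a) + real (Suc (card big) choose 2) + 13 * real z"
        proof (rule small_waste[OF a(1,2)])
          show "(real (r q) - 1) / 2 \<le> 13" if "q \<in> small - {a}" for q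
            using a(3)[OF that] z by simp
        qed (use z in auto)
        then show ?thesis using z sa c5 by simp
      qed
      define t where "t = min (cap - r p) (r a)"
      have t: "r p + t \<le> cap" "t \<le> r a" "t \<ge> 1" unfolding t_def using p(2) False a(2) z by auto
      have "r a - t \<le> cap" using left_small cap_ge a(2) by linarith
      then have "((r p + t) choose 2) + ((r a - t) choose 2) \<le> (r p choose 2) + waste + 2"
        using improve_big[OF p(1) t(1), of "[r a - t]"] g_small[of "r a - t"] t(2) a(2) z by simp
      then have "real ((r p + t) choose 2) + real ((r a - t) choose 2) \<le> real (r p choose 2) + real waste + 2"
        by linarith
      then have "real t * (real (r p) - real (r a) + real t) \<le> 12"
        using choose_two_move[OF t(2), of "r p"] w by linarith
      moreover have "real (r p) - real (r a) + real t \<ge> 13"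
        using big_near_cap[OF u p(1)] cap_ge left_small a(2) n_large by linarith
      then have "1 * 13 \<le> real t * (real (r p) - real (r a) + real t)" using t(3) by (intro mult_mono) auto
      ultimately show False by simp
    qed
  qed
qed

text \<open>If leftover vertices and small stars both exist, \<open>four_big\<close> leaves room for
  the largest small star as one of the four.\<close>

theorem few_stars:
  "\<exists>Q\<subseteq>P. card Q \<le> 4 \<and> kk + j + (\<Sum>p\<in>P - Q. s p) \<le> 470"
proof (cases "left = 0 \<or> small = {}")
  case True
  have "waste \<le> 470" using True waste_left_0 no_small(2) by fastforce
  then show ?thesis using big_subset card_big_le_4 unfolding waste_def small_def by blast
next
  case False
  then obtain a z where a: "a \<in> small" "left = r a + 2 + z"
    "\<And>p. p \<in> small - {a} \<Longrightarrow> r p \<le> r a \<and> r p \<le> z" using largest_small by metis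
  have "card big \<noteq> 4" using four_big False by blast
  then have c3: "card big \<le> 3" using card_big_le_4 by linarith
  have ab: "a \<notin> big" using a(1) unfolding small_def by simp
  have rest: "P - insert a big = small - {a}" unfolding small_def by blast
  have "Suc (card big) choose 2 \<le> 4 choose 2" using c3 by (intro binomial_right_mono) simp
  then have c4: "real (Suc (card big) choose 2) \<le> 6" by (simp add: numeral_eq_Suc)
  have z: "z \<le> 35 \<and> r a + z \<le> 35 \<or> z = 0"
  proof (cases "left \<ge> 38")
    case True then show ?thesis using missed_none[OF a] by simp
  qed (use a(2) in auto)
  \<comment> \<open>If z > 0, then r a and z sum to at most 35, so the other small stars have at
    most 17 leaves and the junk rate 49/4 covers them. The total besides \<open>s a\<close> is at
    most 6 + 49/4 * 35 < 470.\<close>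
  have "real waste \<le> real (s a) + real (Suc (card big) choose 2) + 49 / 4 * real z"
  proof (rule small_waste[OF a(1,2)])
    show "(real (r q) - 1) / 2 \<le> 49 / 4" if "q \<in> small - {a}" for q
    proof -
      have "r q \<le> 17" using a(3)[OF that] z by linarith
      then show ?thesis by simp
    qed
  qed (use z in auto)
  moreover have "real z \<le> 35" using z by auto
  ultimately have "real waste \<le> real (s a) + 470" using c4 by linarith
  then have "waste \<le> s a + 470" by linarith
  moreover have "(\<Sum>p\<in>small. s p) = s a + (\<Sum>p\<in>small - {a}. s p)"
    using sum.remove[OF finite_small a(1)] .
  ultimately have "kk + j + (\<Sum>p\<in>P - insert a big. s p) \<le> 470" unfolding waste_def rest by linarith
  moreover have "insert a big \<subseteq> P" using a(1) big_subset small_subset by blast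
  moreover have "card (insert a big) \<le> 4" using c3 ab finite_big by simp
  ultimately show ?thesis by blast
qed

end

section \<open>Upper bounds for the minimal maximum degree\<close>

lemma max_degree_le:
  assumes "finite (verts H)" "\<And>v. degree H v \<le> D"
  shows "max_degree H \<le> D"
  unfolding max_degree_def using assms by (subst Max_le_iff) auto

text \<open>Discarding edges creates no loose path and raises no degree, so at least m edges suffice
  in a construction.\<close>

lemma min_max_degree_le:
  fixes V :: "nat set"
  assumes V: "finite V" "card V = n"
    and E: "\<And>e. e \<in> E \<Longrightarrow> e \<subseteq> V \<and> card e = 4"
    and free: "\<And>e e'. e \<in> E \<Longrightarrow> e' \<in> E \<Longrightarrow> card (e \<inter> e') \<noteq> 1"
    and m: "m \<le> card E" and deg: "\<And>v. card {e \<in> E. v \<in> e} \<le> D"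
  shows "min_max_degree n m \<le> D"
proof -
  have finE: "finite E" by (rule finite_subset[of _ "Pow V"]) (use V E in auto)
  obtain E' where E': "E' \<subseteq> E" "card E' = m" using obtain_subset_with_card_n[OF m] by metis
  have "(V, E') \<in> P42_free_four_graphs n m"
    using V E'(2) E[OF subsetD[OF E'(1)]] free[OF subsetD[OF E'(1)] subsetD[OF E'(1)]]
    unfolding P42_free_four_graphs_def four_graph_def P42_free_def by simp
  then have "min_max_degree n m \<le> max_degree (V, E')"
    unfolding min_max_degree_def by (intro Least_le) blast
  also have "\<dots> \<le> D"
  proof (rule max_degree_le)
    fix v
    have "card {e \<in> E'. v \<in> e} \<le> card {e \<in> E. v \<in> e}" using E' finE by (intro card_mono) auto
    then show "degree (V, E') v \<le> D" using deg[of v] unfolding degree_def by simp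
  qed (simp add: V)
  finally show ?thesis .
qed

text \<open>The stars occupy consecutive intervals, each centred at its two lowest points. Every
  vertex lies in only one star, so truncating the stars to D edges bounds all degrees.\<close>

lemma disjoint_stars:
  "\<exists>E :: nat set set. (\<forall>e\<in>E. e \<subseteq> {..<(\<Sum>l\<leftarrow>ls. l + 2)} \<and> card e = 4) \<and>
     (\<forall>e\<in>E. \<forall>e'\<in>E. card (e \<inter> e') \<noteq> 1) \<and>
     card E = (\<Sum>l\<leftarrow>ls. min (l choose 2) D) \<and> (\<forall>v. card {e \<in> E. v \<in> e} \<le> D)"
proof (induction ls)
  case Nil
  show ?case by (intro exI[of _ "{}"]) auto
next
  case (Cons l ls)
  define N where "N = (\<Sum>l\<leftarrow>ls. l + 2)"
  obtain E where E': "(\<forall>e\<in>E. e \<subseteq> {..<N} \<and> card e = 4) \<and> (\<forall>e\<in>E. \<forall>e'\<in>E. card (e \<inter> e') \<noteq> 1) \<and>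
     card E = (\<Sum>l\<leftarrow>ls. min (l choose 2) D) \<and> (\<forall>v. card {e \<in> E. v \<in> e} \<le> D)"
    using Cons unfolding N_def by (rule exE)
  then have E: "\<And>e. e \<in> E \<Longrightarrow> e \<subseteq> {..<N} \<and> card e = 4"
      "\<And>e e'. e \<in> E \<Longrightarrow> e' \<in> E \<Longrightarrow> card (e \<inter> e') \<noteq> 1"
      "card E = (\<Sum>l\<leftarrow>ls. min (l choose 2) D)" "\<And>v. card {e \<in> E. v \<in> e} \<le> D"
    by simp_all
  define L where "L = {N + 2..<N + 2 + l}"
  define S where "S = (\<lambda>s. {N, N + 1} \<union> s) ` {s. s \<subseteq> L \<and> card s = 2}"
  have "inj_on (\<lambda>s. {N, N + 1} \<union> s) {s. s \<subseteq> L \<and> card s = 2}"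
  proof (rule inj_onI)
    fix s s' assume s: "s \<in> {s. s \<subseteq> L \<and> card s = 2}" "s' \<in> {s. s \<subseteq> L \<and> card s = 2}"
      "{N, N + 1} \<union> s = {N, N + 1} \<union> s'"
    have "N \<notin> L" "N + 1 \<notin> L" unfolding L_def by auto
    then have "({N, N + 1} \<union> s) - {N, N + 1} = s" "({N, N + 1} \<union> s') - {N, N + 1} = s'" using s(1,2) by auto
    then show "s = s'" unfolding s(3) by (rule trans[OF sym])
  qed
  then have "card S = card L choose 2" unfolding S_def using n_subsets[of L 2] by (simp add: card_image L_def)
  then have cS: "card S = l choose 2" unfolding L_def by simp
  obtain B where B: "B \<subseteq> S" "card B = min (l choose 2) D" "finite B"
    using obtain_subset_with_card_n[of "min (l choose 2) D" S] cS by auto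
  have Be: "e \<subseteq> {N..<N + (l + 2)}" "card e = 4" "N \<in> e" "N + 1 \<in> e" if "e \<in> B" for e
  proof -
    have "e \<in> S" using that B(1) by (rule subsetD[rotated])
    then obtain s where s: "e = {N, N + 1} \<union> s" "s \<subseteq> L" "card s = 2" unfolding S_def by (elim imageE) simp
    show "e \<subseteq> {N..<N + (l + 2)}" using s(1,2) unfolding L_def by auto
    have "finite s" using s(2) by (rule finite_subset) (simp add: L_def)
    moreover have "{N, N + 1} \<inter> s = {}" using s(2) unfolding L_def by auto
    ultimately show "card e = 4" using s card_Un_disjoint[of "{N, N + 1}" s] by simp
    show "N \<in> e" "N + 1 \<in> e" using s by auto
  qed
  have finE: "finite E" by (rule finite_subset[of _ "Pow {..<N}"]) (use E(1) in auto)
  have cross: "e \<inter> e' = {}" if "e \<in> E" "e' \<in> B" for e e'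
    using E(1)[OF that(1)] Be(1)[OF that(2)] by fastforce
  then have disj: "E \<inter> B = {}" using Be(3) by blast
  show ?case
  proof (intro exI[of _ "E \<union> B"] conjI ballI allI)
    fix e assume "e \<in> E \<union> B"
    then show "e \<subseteq> {..<\<Sum>l\<leftarrow>l # ls. l + 2}" "card e = 4"
      using E(1)[of e] Be(1,2)[of e] unfolding N_def by fastforce+
  next
    fix e e' assume e: "e \<in> E \<union> B" "e' \<in> E \<union> B"
    consider "e \<in> E" "e' \<in> E" | "e \<in> E" "e' \<in> B" | "e \<in> B" "e' \<in> E" | "e \<in> B" "e' \<in> B" using e by blast
    then show "card (e \<inter> e') \<noteq> 1"
    proof cases
      case 4
      have "{N, N + 1} \<subseteq> e \<inter> e'" using Be(3,4) 4 by simp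
      moreover have "finite (e \<inter> e')" using Be(2)[OF 4(1)] card_ge_0_finite[of e] by simp
      ultimately have "card {N, N + 1} \<le> card (e \<inter> e')" by (intro card_mono)
      then show ?thesis by simp
    next
      case 3
      then have "e \<inter> e' = {}" using cross[of e' e] by blast
      then show ?thesis by simp
    qed (use E(2) cross in auto)
  next
    show "card (E \<union> B) = (\<Sum>l\<leftarrow>l # ls. min (l choose 2) D)"
      using disj finE B(2,3) E(3) by (simp add: card_Un_disjoint)
  next
    fix v
    show "card {e \<in> E \<union> B. v \<in> e} \<le> D"
    proof (cases "v < N")
      case True
      then have "{e \<in> E \<union> B. v \<in> e} = {e \<in> E. v \<in> e}" using Be(1) by fastforce
      then show ?thesis using E(4) by simp
    next
      case False
      then have "{e \<in> E \<union> B. v \<in> e} \<subseteq> B" using E(1) by fastforce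
      then have "card {e \<in> E \<union> B. v \<in> e} \<le> card B" using B(3) by (intro card_mono)
      then show ?thesis using B(2) by simp
    qed
  qed
qed

lemma min_max_degree_stars:
  assumes "(\<Sum>l\<leftarrow>ls. l + 2) \<le> n" "m \<le> (\<Sum>l\<leftarrow>ls. min (l choose 2) D)"
  shows "min_max_degree n m \<le> D"
proof -
  obtain E :: "nat set set" where E: "\<forall>e\<in>E. e \<subseteq> {..<(\<Sum>l\<leftarrow>ls. l + 2)} \<and> card e = 4"
     "\<forall>e\<in>E. \<forall>e'\<in>E. card (e \<inter> e') \<noteq> 1"
     "card E = (\<Sum>l\<leftarrow>ls. min (l choose 2) D)" "\<forall>v. card {e \<in> E. v \<in> e} \<le> D"
    using disjoint_stars[of ls D] by blast
  show ?thesis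
  proof (rule min_max_degree_le[of "{..<n}" n E])
    show "e \<subseteq> {..<n} \<and> card e = 4" if "e \<in> E" for e using E(1) that assms(1) by fastforce
  qed (use E assms(2) in auto)
qed

text \<open>Each i is replaced by the pair {2 i, 2 i + 1}. The 2-sets become the edges of a thick
  clique, and any two of them meet in an even number of vertices.\<close>

definition doubling :: "nat set \<Rightarrow> nat set" where
  "doubling X = {v. v div 2 \<in> X}"

lemma doubling_card: "finite X \<Longrightarrow> finite (doubling X) \<and> card (doubling X) = 2 * card X"
proof (induction X rule: finite_induct)
  case empty
  then show ?case by (simp add: doubling_def)
next
  case (insert i X)
  have "doubling (insert i X) = {2 * i, 2 * i + 1} \<union> doubling X" unfolding doubling_def by auto
  moreover have "{2 * i, 2 * i + 1} \<inter> doubling X = {}" using insert unfolding doubling_def by auto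
  ultimately show ?case using insert by (simp add: card_Un_disjoint)
qed

lemma doubling_Int: "doubling X \<inter> doubling Y = doubling (X \<inter> Y)"
  unfolding doubling_def by blast

lemma inj_doubling: "inj_on doubling A"
proof (rule inj_onI)
  fix X Y assume eq: "doubling X = doubling Y"
  have "i \<in> Z \<longleftrightarrow> 2 * i \<in> doubling Z" for i Z unfolding doubling_def by simp
  then show "X = Y" using eq by blast
qed

lemma min_max_degree_thick_clique:
  assumes "m \<le> (n div 2) choose 2"
  shows "min_max_degree n m \<le> n div 2"
proof -
  define A where "A = {X. X \<subseteq> {..<n div 2} \<and> card X = 2}"
  have A: "finite X" "X \<subseteq> {..<n div 2}" "card X = 2" if "X \<in> A" for X
    using that card_ge_0_finite[of X] unfolding A_def by auto
  show ?thesis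
  proof (rule min_max_degree_le[of "{..<n}" n "doubling ` A"])
    fix e assume "e \<in> doubling ` A"
    then obtain X where X: "e = doubling X" "X \<in> A" by blast
    have "e \<subseteq> {..<n}" using A(2)[OF X(2)] X(1) unfolding doubling_def by fastforce
    then show "e \<subseteq> {..<n} \<and> card e = 4" using doubling_card[OF A(1)] A(3) X by simp
  next
    fix e e' assume "e \<in> doubling ` A" "e' \<in> doubling ` A"
    then obtain X Y where "e = doubling X" "X \<in> A" "e' = doubling Y" by blast
    then have "card (e \<inter> e') = 2 * card (X \<inter> Y)"
      using doubling_card[of "X \<inter> Y"] A(1) by (simp add: doubling_Int)
    then show "card (e \<inter> e') \<noteq> 1" by simp
  next
    show "m \<le> card (doubling ` A)"
      using assms n_subsets[of "{..<n div 2}" 2] unfolding A_def by (simp add: card_image inj_doubling)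
  next
    fix v
    \<comment> \<open>Admitting i = v div 2 as well only weakens the degree bound from n div 2 - 1
      to n div 2.\<close>
    have "{e \<in> doubling ` A. v \<in> e} \<subseteq> (\<lambda>i. doubling {v div 2, i}) ` {..<n div 2}"
    proof clarify
      fix X assume X: "X \<in> A" "v \<in> doubling X"
      then have v: "v div 2 \<in> X" unfolding doubling_def by simp
      obtain a b where "X = {a, b}" using A(3)[OF X(1)] by (meson card_2_iff)
      then obtain i where "X = {v div 2, i}" using v by auto
      then show "doubling X \<in> (\<lambda>i. doubling {v div 2, i}) ` {..<n div 2}" using A(2)[OF X(1)] by auto
    qed
    then have "card {e \<in> doubling ` A. v \<in> e} \<le> card {..<n div 2}" by (intro surj_card_le) auto
    then show "card {e \<in> doubling ` A. v \<in> e} \<le> n div 2" by simp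
  qed auto
qed

section \<open>Extremal hypergraphs\<close>

context star_decomposition
begin

lemma finite_S: "p \<in> P \<Longrightarrow> finite (S p)"
  using S_subset finite_edges[OF four_graph] finite_subset by blast

lemma card_le_decomposition:
  assumes "A \<subseteq> pair_unions P \<union> J \<union> (\<Union>p\<in>Q. S p)" "Q \<subseteq> P"
  shows "card A \<le> card (pair_unions P) + card J + (\<Sum>p\<in>Q. card (S p))"
proof -
  have fin: "finite Q" using finite_P assms(2) finite_subset by blast
  have "pair_unions P \<subseteq> (\<lambda>(p, q). p \<union> q) ` (P \<times> P)" unfolding pair_unions_def by auto
  then have "finite (pair_unions P)" using finite_P by (meson finite_SigmaI finite_imageI finite_subset)
  moreover have "finite (\<Union>p\<in>Q. S p)" using fin finite_S assms(2) by auto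
  ultimately have "card A \<le> card (pair_unions P \<union> J \<union> (\<Union>p\<in>Q. S p))"
    using finite_J assms(1) by (intro card_mono) simp_all
  also have "\<dots> \<le> card (pair_unions P \<union> J) + card (\<Union>p\<in>Q. S p)" by (rule card_Un_le)
  also have "card (pair_unions P \<union> J) \<le> card (pair_unions P) + card J" by (rule card_Un_le)
  also have "card (\<Union>p\<in>Q. S p) \<le> (\<Sum>p\<in>Q. card (S p))" by (rule card_UN_le[OF fin])
  finally show ?thesis by simp
qed

text \<open>Comparison with a subgraph of a thick clique bounds the maximum degree, hence every
  star, by n/2 edges. That is sparse enough for \<open>nearly_thick\<close>.\<close>

lemma near_thick_clique:
  assumes n: "n \<ge> 1000000"
    and m: "real ((n div 2) choose 2) - real n / 5 \<le> real m" "m \<le> (n div 2) choose 2"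
    and H: "H \<in> extremal_family n m"
  shows "\<exists>T. thick_clique T \<and> card (verts T) = n \<and> subgraph H T"
proof -
  have H': "card (verts H) = n" "card (edges H) = m" "max_degree H = min_max_degree n m"
    using H unfolding extremal_family_def P42_free_four_graphs_def by auto
  have deg: "max_degree H \<le> n div 2" using min_max_degree_thick_clique[OF m(2)] H'(3) by simp
  have "m \<le> (card P choose 2) + (\<Sum>p\<in>P. card (S p)) + card J"
    using card_le_decomposition[OF edges] card_pair_unions[OF finite_P] H'(2) by simp
  then have "real m \<le> real (card P choose 2) + real (\<Sum>p\<in>P. card (S p)) + real (card J)" by linarith
  then have m': "real ((n div 2) choose 2) - real n / 5
      \<le> real (card P choose 2) + real (\<Sum>p\<in>P. card (S p)) + real (card J)" using m(1) by linarith
  \<comment> \<open>Five leaves are the first number for which 9/80 * 5 n = 9 n / 16 exceeds n/2;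
    fewer leaves carry at most two edges each.\<close>
  have rate: "real (card (S p)) \<le> 9 / 80 * real n * real (card (L p))" if p: "p \<in> P" for p
  proof (cases "card (L p) \<ge> 5")
    case True
    have "card (S p) \<le> n div 2" using card_S_degree[OF p] deg by linarith
    then have "real (card (S p)) \<le> 9 / 80 * real n * 5" by simp
    also have "\<dots> \<le> 9 / 80 * real n * real (card (L p))" using True by (intro mult_left_mono) auto
    finally show ?thesis .
  next
    case False
    then have "real (card (L p)) \<le> 5" by simp
    from choose_two_le_mult[OF this] have "real (card (L p) choose 2) \<le> 2 * real (card (L p))" by simp
    also have "\<dots> \<le> 9 / 80 * real n * real (card (L p))" using n by (intro mult_right_mono) auto
    finally show ?thesis using card_S[OF p] by linarith
  qed
  have one: "(\<Sum>p\<in>P. card (L p)) + w \<le> 1"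
    by (rule nearly_thick[OF _ finite_P total[unfolded H'(1)] card_S rate card_J m']) (use n in auto)
  have "S p = {}" if p: "p \<in> P" for p
  proof -
    have "card (L p) \<le> (\<Sum>p\<in>P. card (L p))" using member_le_sum[of p P "\<lambda>p. card (L p)"] p finite_P by simp
    then have "card (L p) = 0" using one L_ne_1[OF p] by linarith
    then have "card (S p) = 0" using card_S[OF p] by (simp add: binomial_eq_0)
    then show ?thesis using finite_S[OF p] by simp
  qed
  moreover have "J = {}" using J_empty one by simp
  ultimately have sub: "edges H \<subseteq> pair_unions P" using edges by auto
  have "card P = card (verts H) div 2" using total one by linarith
  then have "thick_clique (verts H, pair_unions P)"
    using pair disjoint_P four_graph unfolding thick_clique_def four_graph_def pair_unions_def by auto
  then show ?thesis using sub H'(1) unfolding subgraph_def by (intro exI[of _ "(verts H, pair_unions P)"]) auto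
qed

lemma dense_extremal:
  assumes n: "n \<ge> 1000000" and m: "m \<ge> ((n div 2) choose 2) + 1" and H: "H \<in> extremal_family n m"
  shows "real (max_degree H) \<ge> (real n)\<^sup>2 / 32 - real n"
    and "\<exists>D \<subseteq> edges H. card D \<le> 470 \<and> union_of_two_stars 4 (verts H, edges H - D)"
proof -
  have H': "card (verts H) = n" "card (edges H) = m" "max_degree H = min_max_degree n m"
    using H unfolding extremal_family_def P42_free_four_graphs_def by auto
  have le: "m \<le> card (pair_unions P) + card J + (\<Sum>p\<in>P. card (S p))"
    using card_le_decomposition[OF edges] H'(2) by simp
  then have le': "((n div 2) choose 2) + 1 \<le> (card P choose 2) + (\<Sum>p\<in>P. card (S p)) + card J"
    using m card_pair_unions[OF finite_P] by linarith
  have d: "real (max_degree H) \<ge> (real n)\<^sup>2 / 32 + real n / 8"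
    by (rule degree_lower_bound[OF _ finite_P total[unfolded H'(1)] L_ne_1 card_S card_S_degree card_J _ le'])
       (use n J_empty in auto)
  then show "real (max_degree H) \<ge> (real n)\<^sup>2 / 32 - real n" by linarith
  interpret cfg: star_config P "\<lambda>p. card (L p)" "\<lambda>p. card (S p)" n w "card (pair_unions P)" "card J" "max_degree H" m
  proof
    show "card J = 0" if "w \<le> 1" using J_empty[OF that] by simp
    \<comment> \<open>Otherwise disjoint stars would give maximum degree at most
      \<open>max_degree H - 1\<close>. In natural numbers this is contradictory only for a positive
      degree, which \<open>d\<close> supplies.\<close>
    show "(\<Sum>l\<leftarrow>ls. min (l choose 2) (max_degree H - 1)) < m" if "(\<Sum>l\<leftarrow>ls. l + 2) \<le> n" for ls
    proof (rule ccontr)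
      assume "\<not> ?thesis"
      then have "max_degree H \<le> max_degree H - 1"
        using min_max_degree_stars[OF that, of m "max_degree H - 1"] H'(3) by simp
      then have "real (max_degree H) = 0" by simp
      moreover have "(real n)\<^sup>2 / 32 + real n / 8 > 0" using n by (intro add_pos_pos) auto
      ultimately show False using d by linarith
    qed
    show "2 * card P + (\<Sum>p\<in>P. card (L p)) + w = n" using total H'(1) by simp
  qed (use n finite_P card_J card_S card_S_degree m d le card_pair_unions in auto)
  obtain Q where Q: "Q \<subseteq> P" "card Q \<le> 4"
      "card (pair_unions P) + card J + (\<Sum>p\<in>P - Q. card (S p)) \<le> 470"
    using cfg.few_stars by blast
  define D where "D = edges H - (\<Union>p\<in>Q. S p)"
  have "D \<subseteq> pair_unions P \<union> J \<union> (\<Union>p\<in>P - Q. S p)" using edges unfolding D_def by blast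
  then have "card D \<le> 470"
    using card_le_decomposition[of D "P - Q"] Q(3) by auto
  moreover have "union_of_two_stars 4 (verts H, edges H - D)"
    unfolding union_of_two_stars_def
  proof (intro exI[of _ "(\<lambda>p. (p \<union> L p, S p)) ` Q"] conjI ballI)
    have finQ: "finite Q" using Q(1) finite_P finite_subset by blast
    then show "finite ((\<lambda>p. (p \<union> L p, S p)) ` Q)" by simp
    show "card ((\<lambda>p. (p \<union> L p, S p)) ` Q) \<le> 4" using card_image_le[OF finQ] Q(2) le_trans by blast
    show "edges (verts H, edges H - D) = (\<Union>s\<in>(\<lambda>p. (p \<union> L p, S p)) ` Q. edges s)"
      using S_subset Q(1) unfolding D_def by auto
    fix s assume "s \<in> (\<lambda>p. (p \<union> L p, S p)) ` Q"
    then obtain p where p: "s = (p \<union> L p, S p)" "p \<in> P" using Q(1) by blast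
    have sub: "p \<union> L p \<subseteq> verts H" using pair[OF p(2)] L_subset[OF p(2)] by blast
    then show "verts s \<subseteq> verts (verts H, edges H - D)" using p(1) by simp
    have "finite (p \<union> L p)" using sub four_graph finite_subset unfolding four_graph_def by blast
    then have "four_graph s"
      using four_graph S_subset[OF p(2)] S_star[OF p(2)] unfolding p(1) four_graph_def by auto
    moreover obtain u v where "p = {u, v}" "u \<noteq> v" using pair[OF p(2)] by (meson card_2_iff)
    ultimately show "two_star s" using S_star[OF p(2)] unfolding two_star_def p(1) by auto
  next
    show "pairwise (\<lambda>s t. disjnt (verts s) (verts t)) ((\<lambda>p. (p \<union> L p, S p)) ` Q)"
    proof (rule pairwiseI)
      fix s t assume "s \<in> (\<lambda>p. (p \<union> L p, S p)) ` Q" "t \<in> (\<lambda>p. (p \<union> L p, S p)) ` Q" "s \<noteq> t"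
      then obtain p q where pq: "s = (p \<union> L p, S p)" "t = (q \<union> L q, S q)" "p \<in> P" "q \<in> P" "p \<noteq> q"
        using Q(1) by blast
      have "p \<inter> q = {}" using disjoint_P pq unfolding disjoint_def by blast
      moreover have "L p \<inter> L q = {}" using L_disjoint pq by blast
      moreover have "p \<inter> L q = {}" "q \<inter> L p = {}" using L_subset pq by blast+
      ultimately show "disjnt (verts s) (verts t)" unfolding pq disjnt_def by auto
    qed
  qed
  ultimately show "\<exists>D \<subseteq> edges H. card D \<le> 470 \<and> union_of_two_stars 4 (verts H, edges H - D)"
    unfolding D_def by blast
qed

end

lemma extremal_decomposition:
  assumes "H \<in> extremal_family n m"
  shows "\<exists>P L S J w. star_decomposition H P L S J w"
  using assms star_decomposition_exists[of H]
  unfolding extremal_family_def P42_free_four_graphs_def by simp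

theorem theorem4:
  "(\<exists>n1 :: nat. \<forall>n\<ge>n1. \<forall>m :: nat.
      real ((n div 2) choose 2) - real n / 5 \<le> real m \<and> m \<le> (n div 2) choose 2 \<longrightarrow>
      (\<forall>H \<in> (extremal_family n m :: 'a hypergraph set).
         \<exists>T. thick_clique T \<and> card (verts T) = n \<and> subgraph H T))
   \<and>
   (\<exists>n1 :: nat. \<forall>n\<ge>n1. \<forall>m :: nat.
      m \<ge> ((n div 2) choose 2) + 1 \<longrightarrow>
      (\<forall>H \<in> (extremal_family n m :: 'a hypergraph set).
         real (max_degree H) \<ge> (real n)\<^sup>2 / 32 - real n \<and>
         (\<exists>D \<subseteq> edges H. card D \<le> 470 \<and> union_of_two_stars 4 (verts H, edges H - D))))"
proof (intro conjI exI[of _ 1000000] allI impI ballI)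
  fix n m :: nat and H :: "'a hypergraph"
  assume n: "1000000 \<le> n" and H: "H \<in> extremal_family n m"
  obtain P L S J w where dec: "star_decomposition H P L S J w" using extremal_decomposition[OF H] by blast
  show "\<exists>T. thick_clique T \<and> card (verts T) = n \<and> subgraph H T"
    if "real ((n div 2) choose 2) - real n / 5 \<le> real m \<and> m \<le> (n div 2) choose 2"
    using star_decomposition.near_thick_clique[OF dec n _ _ H] that by blast
  show "real (max_degree H) \<ge> (real n)\<^sup>2 / 32 - real n"
    if "m \<ge> ((n div 2) choose 2) + 1"
    by (rule star_decomposition.dense_extremal(1)[OF dec n that H])
  show "\<exists>D \<subseteq> edges H. card D \<le> 470 \<and> union_of_two_stars 4 (verts H, edges H - D)"
    if "m \<ge> ((n div 2) choose 2) + 1"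
    by (rule star_decomposition.dense_extremal(2)[OF dec n that H])
qed

end
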